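(* Let $(\Sigma,\mathcal M,\mathcal P)$ be a marked surface with non-empty boundary and non-empty set of punctures, not a once-punctured monogon, with an ideal triangulation $\tau$ such that each puncture belongs to a self-folded triangle and no triangle shares a side with two self-folded triangles, and let $\widetilde\Sigma=(\Sigma^+\sqcup\Sigma^-)/(\Psi_P,P\in\mathcal P)$ be the associated surface. The homeomorphism $S:\Sigma^+\sqcup\Sigma^-\to\Sigma^+\sqcup\Sigma^-$ exchanging $\Sigma^+$ and $\Sigma^-$ induces a homeomorphism $\sigma:\widetilde\Sigma\to\widetilde\Sigma$ of order $2$ whose fixed points are (the images in $\widetilde\Sigma$ of) the points $P^+$, $P\in\mathcal P$.
   Context: $\Sigma$ is a compact (the paper says "closed") connected oriented surface with non-empty boundary; $\mathcal M$ is a finite set of marked points on $\partial\Sigma$, at least one on each boundary component; $\mathcal P$ is a finite non-empty set of points (punctures) in the interior. Ideal triangulations are in the sense of Fomin–Shapiro–Thurston; a self-folded triangle consists of a loop based at a point $A$ enclosing exactly one puncture $P$ and of the folded side $i_P$ joining $A$ to $P$ inside the loop. With the assumptions on $\tau$, the endpoint of $i_P$ other than $P$ is in $\mathcal M$. $\Sigma^+$ is the surface obtained by cutting $\Sigma$ along all folded sides $i_P$, $P\in\mathcal P$. Each $i_P$ becomes a boundary segment $[P_1^+,P_2^+]$ of $\Sigma^+$ (oriented by the orientation of the boundary), whose endpoints come from the marked point $A$ of $i_P$ and which runs along $i_P$ from $A$ to $P$ and back; if several punctures are linked to the same marked point, the corresponding segments are consecutive on the boundary (e.g. $P_2^+=Q_1^+$),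 but a boundary component of $\Sigma^+$ is never covered by such segments. Fix homeomorphisms $\varphi_P:[P_1^+,P_2^+]\to[0,1]$ respecting the orientation, such that folding each $[P_1^+,P_2^+]$ by $x\sim\varphi_P^{-1}(1-\varphi_P(x))$ recovers $\Sigma$ from $\Sigma^+$, and put $P^+=\varphi_P^{-1}(1/2)$. $\Sigma^-$ is another copy of $\Sigma^+$ (with corresponding segments $[P_1^-,P_2^-]$), $S$ (an involution) exchanges the two copies, and $\Psi_P:[P_1^+,P_2^+]\to[P_1^-,P_2^-]$ is $\Psi_P(x)=S\big(\varphi_P^{-1}(1-\varphi_P(x))\big)$. $\widetilde\Sigma$ is obtained from $\Sigma^+\sqcup\Sigma^-$ by identifying $x$ with $\Psi_P(x)$ for all $P\in\mathcal P$ and $x\in[P_1^+,P_2^+]$. *)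

theory Defs
  imports "HOL-Analysis.Analysis" "HOL-Complex_Analysis.Complex_Analysis"
begin

section \<open>Oriented surfaces with boundary\<close>

abbreviation closed_half_plane :: "complex set" where
  "closed_half_plane \<equiv> {z. Im z \<ge> 0}"

text \<open>A chart is a domain together with a coordinate function; the function is irrelevant
  outside its domain.\<close>

type_synonym 'a chart = "'a set \<times> ('a \<Rightarrow> complex)"

definition surface_chart :: "'a topology \<Rightarrow> 'a chart \<Rightarrow> bool" where
  "surface_chart X c \<longleftrightarrow> (case c of (U, f) \<Rightarrow>
     openin X U \<and> openin (top_of_set closed_half_plane) (f ` U) \<and>
     homeomorphic_map (subtopology X U) (top_of_set (f ` U)) f)"

text \<open>A local homeomorphism of the plane preserves the orientation at a point iff it maps small
  counterclockwise circles around the point to loops of winding number 1 around its image.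
  Only interior points of the charts are tested; they are dense.\<close>

definition orientation_preserving_on ::
  "'a chart set \<Rightarrow> 'b chart set \<Rightarrow> 'a set \<Rightarrow> ('a \<Rightarrow> 'b) \<Rightarrow> bool" where
  "orientation_preserving_on \<A> \<B> W h \<longleftrightarrow>
     (\<forall>(U, f) \<in> \<A>. \<forall>(V, g) \<in> \<B>. \<forall>x \<in> U \<inter> W. h x \<in> V \<and> Im (f x) > 0 \<longrightarrow>
        (\<exists>e>0. \<forall>r. 0 < r \<and> r < e \<longrightarrow>
           winding_number (\<lambda>t. g (h (inv_into U f (circlepath (f x) r t)))) (g (h x)) = 1))"

definition oriented_surface :: "'a topology \<Rightarrow> 'a chart set \<Rightarrow> bool" where
  "oriented_surface X \<A> \<longleftrightarrow>
     Hausdorff_space X \<and> second_countable X \<and>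
     (\<forall>c \<in> \<A>. surface_chart X c) \<and> (\<Union>(U, f) \<in> \<A>. U) = topspace X \<and>
     orientation_preserving_on \<A> \<A> (topspace X) (\<lambda>x. x)"

definition surface_boundary :: "'a chart set \<Rightarrow> 'a set" where
  "surface_boundary \<A> = {x. \<exists>(U, f) \<in> \<A>. x \<in> U \<and> Im (f x) = 0}"

text \<open>The boundary orientation has the surface on its left; in an oriented chart to the upper
  half-plane this is the direction of increasing real part.\<close>

definition boundary_oriented :: "'a chart set \<Rightarrow> (real \<Rightarrow> 'a) \<Rightarrow> bool" where
  "boundary_oriented \<A> \<gamma> \<longleftrightarrow>
     (\<forall>(U, f) \<in> \<A>. \<forall>t \<in> {0..1}. \<gamma> t \<in> U \<longrightarrow>
        (\<exists>e>0. strict_mono_on {s \<in> {0..1}. \<bar>s - t\<bar> < e} (\<lambda>s. Re (f (\<gamma> s)))))"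


section \<open>Marked surfaces, arcs and ideal triangulations\<close>

definition marked_surface :: "'a topology \<Rightarrow> 'a chart set \<Rightarrow> 'a set \<Rightarrow> 'a set \<Rightarrow> bool" where
  "marked_surface X \<A> M \<P> \<longleftrightarrow>
     oriented_surface X \<A> \<and> compact_space X \<and> connected_space X \<and>
     finite M \<and> M \<subseteq> surface_boundary \<A> \<and>
     (\<forall>C \<in> connected_components_of (subtopology X (surface_boundary \<A>)). C \<inter> M \<noteq> {}) \<and>
     finite \<P> \<and> \<P> \<subseteq> topspace X - surface_boundary \<A>"

definition once_punctured_monogon :: "'a topology \<Rightarrow> 'a set \<Rightarrow> 'a set \<Rightarrow> bool" where
  "once_punctured_monogon X M \<P> \<longleftrightarrow>
     X homeomorphic_space top_of_set (cball (0::complex) 1) \<and> card M = 1 \<and> card \<P> = 1"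

text \<open>In the next definitions the set \<open>V\<close> consists of all marked points, punctures included.
  A disc embedded in the surface is given by a parametrization by the closed unit disc.\<close>

definition embedded_disc :: "'a topology \<Rightarrow> (complex \<Rightarrow> 'a) \<Rightarrow> bool" where
  "embedded_disc X c \<longleftrightarrow>
     continuous_map (top_of_set (cball 0 1)) X c \<and> inj_on c (cball 0 1)"

definition cuts_out_unpunctured_monogon :: "'a topology \<Rightarrow> 'a set \<Rightarrow> (real \<Rightarrow> 'a) \<Rightarrow> bool" where
  "cuts_out_unpunctured_monogon X V \<gamma> \<longleftrightarrow>
     (\<exists>c. embedded_disc X c \<and> c ` sphere 0 1 = \<gamma> ` {0..1} \<and> c ` ball 0 1 \<inter> V = {})"

text \<open>The digon has one side on \<open>\<gamma>\<close> and one on the boundary. Its vertices are \<open>c 1\<close> and \<open>c (-1)\<close>,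
  which coincide if \<open>\<gamma>\<close> is a loop parallel to a boundary component with one marked point.\<close>

definition cuts_out_unpunctured_digon ::
  "'a topology \<Rightarrow> 'a chart set \<Rightarrow> 'a set \<Rightarrow> (real \<Rightarrow> 'a) \<Rightarrow> bool" where
  "cuts_out_unpunctured_digon X \<A> V \<gamma> \<longleftrightarrow>
     (\<exists>c. continuous_map (top_of_set (cball 0 1)) X c \<and>
        inj_on c (cball 0 1 - {1, -1}) \<and> c ` {1, -1} \<inter> c ` (cball 0 1 - {1, -1}) = {} \<and>
        c ` {z \<in> sphere 0 1. Im z \<ge> 0} = \<gamma> ` {0..1} \<and>
        c ` {z \<in> sphere 0 1. Im z \<le> 0} \<subseteq> surface_boundary \<A> \<and>
        c ` (cball 0 1 - {1, -1}) \<inter> V = {})"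

definition arc_in :: "'a topology \<Rightarrow> 'a chart set \<Rightarrow> 'a set \<Rightarrow> (real \<Rightarrow> 'a) \<Rightarrow> bool" where
  "arc_in X \<A> V \<gamma> \<longleftrightarrow>
     pathin X \<gamma> \<and> \<gamma> 0 \<in> V \<and> \<gamma> 1 \<in> V \<and>
     (\<forall>s \<in> {0..1}. \<forall>t \<in> {0..1}. \<gamma> s = \<gamma> t \<longrightarrow> s = t \<or> {s, t} = {0, 1}) \<and>
     \<gamma> ` {0<..<1} \<inter> (V \<union> surface_boundary \<A>) = {} \<and>
     \<not> cuts_out_unpunctured_monogon X V \<gamma> \<and> \<not> cuts_out_unpunctured_digon X \<A> V \<gamma>"

text \<open>Isotopy inside the class of arcs. Arcs are unoriented, hence the second alternative.\<close>

definition isotopic_arcs ::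
  "'a topology \<Rightarrow> 'a chart set \<Rightarrow> 'a set \<Rightarrow> (real \<Rightarrow> 'a) \<Rightarrow> (real \<Rightarrow> 'a) \<Rightarrow> bool" where
  "isotopic_arcs X \<A> V \<gamma> \<delta> \<longleftrightarrow>
     (\<exists>H :: real \<times> real \<Rightarrow> 'a.
        continuous_map (top_of_set ({0..1} \<times> {0..1})) X H \<and>
        (\<forall>s \<in> {0..1}. arc_in X \<A> V (\<lambda>t. H (s, t))) \<and>
        (\<forall>t \<in> {0..1}. H (0, t) = \<gamma> t) \<and>
        ((\<forall>t \<in> {0..1}. H (1, t) = \<delta> t) \<or> (\<forall>t \<in> {0..1}. H (1, t) = \<delta> (1 - t))))"

definition noncrossing :: "(real \<Rightarrow> 'a) \<Rightarrow> (real \<Rightarrow> 'a) \<Rightarrow> bool" where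
  "noncrossing \<gamma> \<delta> \<longleftrightarrow> \<gamma> ` {0<..<1} \<inter> \<delta> ` {0<..<1} = {}"

definition compatible_arcs ::
  "'a topology \<Rightarrow> 'a chart set \<Rightarrow> 'a set \<Rightarrow> (real \<Rightarrow> 'a) \<Rightarrow> (real \<Rightarrow> 'a) \<Rightarrow> bool" where
  "compatible_arcs X \<A> V \<gamma> \<delta> \<longleftrightarrow>
     (\<exists>\<gamma>' \<delta>'. isotopic_arcs X \<A> V \<gamma> \<gamma>' \<and> isotopic_arcs X \<A> V \<delta> \<delta>' \<and> noncrossing \<gamma>' \<delta>')"

text \<open>A maximal collection of pairwise compatible, pairwise non-isotopic arcs, realized by curves
  that are simultaneously pairwise non-crossing.\<close>

definition ideal_triangulation ::
  "'a topology \<Rightarrow> 'a chart set \<Rightarrow> 'a set \<Rightarrow> (real \<Rightarrow> 'a) set \<Rightarrow> bool" where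
  "ideal_triangulation X \<A> V \<tau> \<longleftrightarrow>
     (\<forall>\<alpha> \<in> \<tau>. arc_in X \<A> V \<alpha>) \<and>
     (\<forall>\<alpha> \<in> \<tau>. \<forall>\<beta> \<in> \<tau>. \<alpha> \<noteq> \<beta> \<longrightarrow> noncrossing \<alpha> \<beta> \<and> \<not> isotopic_arcs X \<A> V \<alpha> \<beta>) \<and>
     (\<forall>\<gamma>. arc_in X \<A> V \<gamma> \<and> (\<forall>\<alpha> \<in> \<tau>. compatible_arcs X \<A> V \<gamma> \<alpha>) \<longrightarrow>
        (\<exists>\<alpha> \<in> \<tau>. isotopic_arcs X \<A> V \<gamma> \<alpha>))"

text \<open>Triangles are represented by their interiors, the complementary regions of the arcs.\<close>

definition triangles :: "'a topology \<Rightarrow> 'a chart set \<Rightarrow> (real \<Rightarrow> 'a) set \<Rightarrow> 'a set set" where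
  "triangles X \<A> \<tau> = connected_components_of
     (subtopology X (topspace X - surface_boundary \<A> - (\<Union>\<alpha> \<in> \<tau>. \<alpha> ` {0..1})))"

definition share_side :: "'a topology \<Rightarrow> (real \<Rightarrow> 'a) set \<Rightarrow> 'a set \<Rightarrow> 'a set \<Rightarrow> bool" where
  "share_side X \<tau> \<Delta> \<Delta>' \<longleftrightarrow> \<Delta> \<noteq> \<Delta>' \<and>
     (\<exists>\<alpha> \<in> \<tau>. \<alpha> ` {0..1} \<subseteq> X closure_of \<Delta> \<and> \<alpha> ` {0..1} \<subseteq> X closure_of \<Delta>')"

text \<open>The loop \<open>L\<close> is based at \<open>L 0\<close> and encloses the puncture \<open>P\<close> only; the folded side \<open>i\<close> joins
  \<open>L 0\<close> to \<open>P\<close> inside the loop.\<close>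

definition self_folded_triangle ::
  "'a topology \<Rightarrow> 'a chart set \<Rightarrow> 'a set \<Rightarrow> (real \<Rightarrow> 'a) set \<Rightarrow>
   'a set \<Rightarrow> (real \<Rightarrow> 'a) \<Rightarrow> (real \<Rightarrow> 'a) \<Rightarrow> 'a \<Rightarrow> bool" where
  "self_folded_triangle X \<A> V \<tau> \<Delta> L i P \<longleftrightarrow>
     \<Delta> \<in> triangles X \<A> \<tau> \<and> L \<in> \<tau> \<and> i \<in> \<tau> \<and> L 0 = L 1 \<and> {i 0, i 1} = {L 0, P} \<and>
     (\<exists>c. embedded_disc X c \<and> c ` sphere 0 1 = L ` {0..1} \<and> c ` ball 0 1 \<inter> V = {P} \<and>
        i ` {0..1} \<subseteq> c ` cball 0 1 \<and> \<Delta> = c ` ball 0 1 - i ` {0..1})"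

definition triangle_with_two_self_folded_neighbours ::
  "'a topology \<Rightarrow> 'a chart set \<Rightarrow> 'a set \<Rightarrow> (real \<Rightarrow> 'a) set \<Rightarrow> bool" where
  "triangle_with_two_self_folded_neighbours X \<A> V \<tau> \<longleftrightarrow>
     (\<exists>\<Delta> \<in> triangles X \<A> \<tau>. \<exists>\<Delta>\<^sub>1 \<Delta>\<^sub>2. \<Delta>\<^sub>1 \<noteq> \<Delta>\<^sub>2 \<and>
        (\<exists>L i P. self_folded_triangle X \<A> V \<tau> \<Delta>\<^sub>1 L i P) \<and>
        (\<exists>L i P. self_folded_triangle X \<A> V \<tau> \<Delta>\<^sub>2 L i P) \<and>
        share_side X \<tau> \<Delta> \<Delta>\<^sub>1 \<and> share_side X \<tau> \<Delta> \<Delta>\<^sub>2)"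


section \<open>Cutting along the folded sides\<close>

text \<open>The boundary segment of the puncture \<open>P\<close> is \<open>E P\<close>, with the homeomorphism \<open>\<phi> P\<close> from it to the
  unit interval; \<open>seg_point E \<phi> P\<close> is the inverse of \<open>\<phi> P\<close>. The point \<open>P\<^sup>+\<close> is
  \<open>seg_point E \<phi> P (1/2)\<close>.\<close>

definition seg_point :: "('a \<Rightarrow> 'b set) \<Rightarrow> ('a \<Rightarrow> 'b \<Rightarrow> real) \<Rightarrow> 'a \<Rightarrow> real \<Rightarrow> 'b" where
  "seg_point E \<phi> P = inv_into (E P) (\<phi> P)"

definition fold_step ::
  "'a set \<Rightarrow> ('a \<Rightarrow> 'b set) \<Rightarrow> ('a \<Rightarrow> 'b \<Rightarrow> real) \<Rightarrow> 'b \<Rightarrow> 'b \<Rightarrow> bool" where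
  "fold_step \<P> E \<phi> x y \<longleftrightarrow> (\<exists>P \<in> \<P>. x \<in> E P \<and> y = seg_point E \<phi> P (1 - \<phi> P x))"

text \<open>\<open>(Y, \<B>)\<close> is the surface obtained by cutting \<open>(X, \<A>)\<close> along the arcs \<open>i P\<close>, and \<open>\<pi>\<close> is the map
  that glues it back. Cutting is characterized by: \<open>Y\<close> is a compact oriented surface, each segment
  \<open>E P\<close> runs along \<open>i P\<close> from its other endpoint to \<open>P\<close> (and then back, by the folding), \<open>\<pi>\<close>
  identifies \<open>X\<close> with the quotient of \<open>Y\<close> by the folding of the segments, and \<open>\<pi>\<close> preserves the
  orientation off the segments.\<close>

definition cut_surface ::
  "'a topology \<Rightarrow> 'a chart set \<Rightarrow> 'a set \<Rightarrow> ('a \<Rightarrow> real \<Rightarrow> 'a) \<Rightarrow>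
   'b topology \<Rightarrow> 'b chart set \<Rightarrow> ('b \<Rightarrow> 'a) \<Rightarrow> ('a \<Rightarrow> 'b set) \<Rightarrow> ('a \<Rightarrow> 'b \<Rightarrow> real) \<Rightarrow> bool" where
  "cut_surface X \<A> \<P> i Y \<B> \<pi> E \<phi> \<longleftrightarrow>
     oriented_surface Y \<B> \<and> compact_space Y \<and>
     (\<forall>P \<in> \<P>.
        E P \<subseteq> surface_boundary \<B> \<and>
        homeomorphic_map (subtopology Y (E P)) (top_of_set {0..1}) (\<phi> P) \<and>
        boundary_oriented \<B> (seg_point E \<phi> P) \<and>
        inj_on (\<pi> \<circ> seg_point E \<phi> P) {0..1/2} \<and>
        (\<pi> \<circ> seg_point E \<phi> P) ` {0..1/2} = i P ` {0..1} \<and>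
        {\<pi> (seg_point E \<phi> P 0), P} = {i P 0, i P 1} \<and>
        \<pi> (seg_point E \<phi> P (1/2)) = P) \<and>
     quotient_map Y X \<pi> \<and>
     (\<forall>x \<in> topspace Y. \<forall>y \<in> topspace Y. \<pi> x = \<pi> y \<longleftrightarrow> equivclp (fold_step \<P> E \<phi>) x y) \<and>
     orientation_preserving_on \<B> \<A> (topspace Y - (\<Union>P \<in> \<P>. E P)) \<pi>"


section \<open>The doubled surface\<close>

text \<open>Quotient of \<open>X\<close> by the equivalence relation generated by \<open>R\<close>; its points are the classes.
  The relation \<open>R\<close> is meant to relate points of \<open>X\<close> only.\<close>

definition glue_class :: "('a \<Rightarrow> 'a \<Rightarrow> bool) \<Rightarrow> 'a \<Rightarrow> 'a set" where
  "glue_class R x = {y. equivclp R x y}"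

definition glue_topology :: "'a topology \<Rightarrow> ('a \<Rightarrow> 'a \<Rightarrow> bool) \<Rightarrow> 'a set topology" where
  "glue_topology X R = topology (\<lambda>U. U \<subseteq> glue_class R ` topspace X \<and>
     openin X {x \<in> topspace X. glue_class R x \<in> U})"

lemma openin_glue_topology:
  "openin (glue_topology X R) U \<longleftrightarrow>
     U \<subseteq> glue_class R ` topspace X \<and> openin X {x \<in> topspace X. glue_class R x \<in> U}"
proof -
  have "istopology (\<lambda>U. U \<subseteq> glue_class R ` topspace X \<and>
     openin X {x \<in> topspace X. glue_class R x \<in> U})"
    unfolding istopology_def
  proof (intro conjI allI impI)
    fix S T assume S: "S \<subseteq> glue_class R ` topspace X \<and> openin X {x \<in> topspace X. glue_class R x \<in> S}"
      and T: "T \<subseteq> glue_class R ` topspace X \<and> openin X {x \<in> topspace X. glue_class R x \<in> T}"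
    have "{x \<in> topspace X. glue_class R x \<in> S \<inter> T} =
        {x \<in> topspace X. glue_class R x \<in> S} \<inter> {x \<in> topspace X. glue_class R x \<in> T}" by auto
    then show "openin X {x \<in> topspace X. glue_class R x \<in> S \<inter> T}"
      using S T by (simp add: openin_Int)
  next
    fix K assume K: "\<forall>S\<in>K. S \<subseteq> glue_class R ` topspace X \<and> openin X {x \<in> topspace X. glue_class R x \<in> S}"
    have "{x \<in> topspace X. glue_class R x \<in> \<Union>K} =
        \<Union>((\<lambda>S. {x \<in> topspace X. glue_class R x \<in> S}) ` K)" by auto
    then show "openin X {x \<in> topspace X. glue_class R x \<in> \<Union>K}"
      using K by (metis (no_types, lifting) imageE openin_Union)
  qed auto
  then show ?thesis
    by (simp add: glue_topology_def topology_inverse')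
qed

lemma topspace_glue_topology: "topspace (glue_topology X R) = glue_class R ` topspace X"
proof
  show "topspace (glue_topology X R) \<subseteq> glue_class R ` topspace X"
    using openin_glue_topology openin_topspace by blast
  have "{x \<in> topspace X. glue_class R x \<in> glue_class R ` topspace X} = topspace X" by auto
  then have "openin (glue_topology X R) (glue_class R ` topspace X)"
    by (simp add: openin_glue_topology)
  then show "glue_class R ` topspace X \<subseteq> topspace (glue_topology X R)"
    by (rule openin_subset)
qed

lemma quotient_map_glue_class: "quotient_map X (glue_topology X R) (glue_class R)"
  by (simp add: quotient_map_def topspace_glue_topology openin_glue_topology)

text \<open>The copies \<open>\<Sigma>\<^sup>+\<close> and \<open>\<Sigma>\<^sup>-\<close> have the tags \<open>True\<close> and \<open>False\<close> in the disjoint union.\<close>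

definition two_copies :: "'b topology \<Rightarrow> (bool \<times> 'b) topology" where
  "two_copies Y = sum_topology (\<lambda>_. Y) UNIV"

definition swap_copies :: "bool \<times> 'b \<Rightarrow> bool \<times> 'b" where
  "swap_copies = (\<lambda>(b, x). (\<not> b, x))"

definition Psi :: "('a \<Rightarrow> 'b set) \<Rightarrow> ('a \<Rightarrow> 'b \<Rightarrow> real) \<Rightarrow> 'a \<Rightarrow> bool \<times> 'b \<Rightarrow> bool \<times> 'b" where
  "Psi E \<phi> P = (\<lambda>(b, x). swap_copies (b, seg_point E \<phi> P (1 - \<phi> P x)))"

definition Psi_step ::
  "'a set \<Rightarrow> ('a \<Rightarrow> 'b set) \<Rightarrow> ('a \<Rightarrow> 'b \<Rightarrow> real) \<Rightarrow> bool \<times> 'b \<Rightarrow> bool \<times> 'b \<Rightarrow> bool" where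
  "Psi_step \<P> E \<phi> x y \<longleftrightarrow> (\<exists>P \<in> \<P>. x \<in> {True} \<times> E P \<and> y = Psi E \<phi> P x)"

definition doubled_surface ::
  "'a set \<Rightarrow> 'b topology \<Rightarrow> ('a \<Rightarrow> 'b set) \<Rightarrow> ('a \<Rightarrow> 'b \<Rightarrow> real) \<Rightarrow> (bool \<times> 'b) set topology" where
  "doubled_surface \<P> Y E \<phi> = glue_topology (two_copies Y) (Psi_step \<P> E \<phi>)"

definition doubled_proj ::
  "'a set \<Rightarrow> ('a \<Rightarrow> 'b set) \<Rightarrow> ('a \<Rightarrow> 'b \<Rightarrow> real) \<Rightarrow> bool \<times> 'b \<Rightarrow> (bool \<times> 'b) set" where
  "doubled_proj \<P> E \<phi> = glue_class (Psi_step \<P> E \<phi>)"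

end

theory Submission
  imports Defs
begin

text \<open>A point over an interior point of a segment is glued to exactly one other point, its mirror image
  in the other copy, so it is fixed only at the midpoint. Ends of segments are glued in chains along
  consecutive segments, and such a chain could join the two copies of a point only if an odd number of
  segments covered a whole boundary component. That is impossible: folding such a component gives
  a point with a neighbourhood free of other boundary points, whereas all ends of segments map to
  marked points of the boundary. The latter holds because a loop based at a puncture would enter
  the once-punctured disc around that puncture, which meets no arc but the folded side.\<close>

section \<open>Deterministic relations and quotients\<close>

text \<open>Boundary components of \<open>Y\<close> never appear as objects; fibres of
  \<open>\<pi>\<close> over marked points take their role. A fold step and a gluing step move the
  underlying point of \<open>Y\<close> in the same way and differ only in the change of copy, so a
  chain of gluings through an end of a segment stays in one fibre. Since all segments follow the
  boundary orientation, at most one starts and at most one ends at any point: such a fibre is a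
  directed path or a cycle. A free end, found by topology, excludes the cycle, and on a path the
  parity of the distance to the free end separates the two copies. The topological input is
  invariance of domain: the boundary is defined by the existence of a suitable chart, so its
  independence of the chart has to be proved, as does the fact that \<open>\<pi>\<close> sends no
  interior point of \<open>Y\<close> to the boundary of \<open>X\<close>. That two points are not
  glued is always shown by a set closed under the steps that contains only one of them.\<close>

lemma equivclp_invariant:
  assumes "equivclp r x y" and "\<And>u v. r u v \<Longrightarrow> u \<in> S \<longleftrightarrow> v \<in> S"
  shows "x \<in> S \<longleftrightarrow> y \<in> S"
  using assms(1)
proof (induction rule: equivclp_induct)
  case (step y z)
  then show ?case
    using assms(2) by metis
qed simp

text \<open>Determinism makes the path from a point to \<open>v\<close> unique, and as
  \<open>v\<close> emits no edge the path stops there. Its length is therefore well defined, and its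
  parity is the colour. An odd cycle through \<open>v\<close> would admit no such colouring, which
  is why \<open>v\<close> has to be a sink.\<close>

lemma parity_colouring:
  fixes r :: "'a \<Rightarrow> 'a \<Rightarrow> bool"
  assumes det: "\<And>x y z. r x y \<Longrightarrow> r x z \<Longrightarrow> y = z" and sink: "\<And>y. \<not> r v y"
  shows "\<exists>c :: 'a \<Rightarrow> bool. \<forall>x y. r x y \<and> r\<^sup>*\<^sup>* y v \<longrightarrow> c x \<noteq> c y"
proof -
  have uniq: "m = n" if "(r ^^ m) x v" "(r ^^ n) x v" for m n x
    using that
  proof (induction m arbitrary: x n)
    case 0
    then show ?case
      by (metis relpowp_0_E relpowp_E2 sink)
  next
    case (Suc m)
    obtain y where y: "r x y" "(r ^^ m) y v"
      using relpowp_Suc_D2[OF Suc.prems(1)] by blast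
    then have "n \<noteq> 0"
      using Suc.prems(2) sink by (metis relpowp_0_E)
    then obtain k where k: "n = Suc k"
      using not0_implies_Suc by blast
    then obtain z where "r x z" "(r ^^ k) z v"
      using relpowp_Suc_D2 Suc.prems(2) by metis
    then show ?case
      using Suc.IH[OF y(2)] det[OF y(1)] k by blast
  qed
  define c where "c x \<longleftrightarrow> (\<exists>n. even n \<and> (r ^^ n) x v)" for x
  have "c x \<noteq> c y" if xy: "r x y" and "r\<^sup>*\<^sup>* y v" for x y
  proof -
    obtain k where k: "(r ^^ k) y v"
      using \<open>r\<^sup>*\<^sup>* y v\<close> by (metis rtranclp_power)
    have "(r ^^ Suc k) x v"
      using xy k by (rule relpowp_Suc_I2)
    then have "c x \<longleftrightarrow> even (Suc k)" and "c y \<longleftrightarrow> even k"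
      unfolding c_def using k uniq by metis+
    then show ?thesis
      by simp
  qed
  then show ?thesis
    by (intro exI[of _ c] allI impI) blast
qed

lemma continuous_map_inv_into:
  assumes "homeomorphic_map X Y f"
  shows "continuous_map Y X (inv_into (topspace X) f)"
proof -
  obtain g where g: "homeomorphic_maps X Y f g"
    using assms homeomorphic_map_maps by blast
  have inj: "inj_on f (topspace X)"
    using assms by (simp add: homeomorphic_map_def)
  show ?thesis
  proof (rule continuous_map_eq[of _ _ g])
    show "continuous_map Y X g"
      using g by (simp add: homeomorphic_maps_def)
    fix y assume y: "y \<in> topspace Y"
    then have "g y \<in> topspace X" "f (g y) = y"
      using g by (auto simp: homeomorphic_maps_def continuous_map_def)
    then show "g y = inv_into (topspace X) f y"
      using inj by (metis inv_into_f_f)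
  qed
qed


section \<open>Charts and invariance of domain\<close>

lemma oriented_surface_chart:
  assumes "oriented_surface X \<A>" "(U, f) \<in> \<A>"
  shows "surface_chart X (U, f)"
  using assms by (auto simp: oriented_surface_def)

lemma oriented_surface_cover:
  assumes "oriented_surface X \<A>" "x \<in> topspace X"
  obtains U f where "(U, f) \<in> \<A>" "x \<in> U"
  using assms unfolding oriented_surface_def by blast

lemma surface_chartD:
  assumes "surface_chart X (U, f)"
  shows "openin X U" "U \<subseteq> topspace X" "inj_on f U" "f ` U \<subseteq> closed_half_plane"
    "continuous_map (subtopology X U) euclidean f"
    "continuous_map (top_of_set (f ` U)) X (inv_into U f)"
proof -
  have h: "homeomorphic_map (subtopology X U) (top_of_set (f ` U)) f"
    using assms by (simp add: surface_chart_def)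
  show U: "openin X U"
    using assms by (simp add: surface_chart_def)
  then show sub: "U \<subseteq> topspace X"
    by (rule openin_subset)
  then have ts: "topspace (subtopology X U) = U"
    by auto
  show "inj_on f U"
    using h ts by (metis homeomorphic_map_def)
  show "f ` U \<subseteq> closed_half_plane"
    using assms openin_imp_subset unfolding surface_chart_def by blast
  show "continuous_map (subtopology X U) euclidean f"
    using homeomorphic_imp_continuous_map[OF h] by (rule continuous_map_into_fulltopology)
  show "continuous_map (top_of_set (f ` U)) X (inv_into U f)"
    using continuous_map_inv_into[OF h] ts continuous_map_into_fulltopology by metis
qed

lemma surface_chart_image_open:
  assumes "surface_chart X (U, f)" "openin X T" "T \<subseteq> U"
  shows "openin (top_of_set closed_half_plane) (f ` T)"
proof -
  have h: "homeomorphic_map (subtopology X U) (top_of_set (f ` U)) f"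
    and o: "openin (top_of_set closed_half_plane) (f ` U)"
    using assms by (auto simp: surface_chart_def)
  have "openin (subtopology X U) T"
    using assms by (simp add: openin_subset_topspace_eq openin_subtopology_Int2 inf.absorb2
        subset_openin_subtopology)
  then have "openin (top_of_set (f ` U)) (f ` T)"
    using homeomorphic_imp_open_map[OF h] by (auto simp: open_map_def)
  then show ?thesis
    using o openin_trans by blast
qed

lemma surface_chart_preimage_open:
  assumes "surface_chart X (U, f)" "open S"
  shows "openin X {x \<in> U. f x \<in> S}"
proof -
  note c = surface_chartD[OF assms(1)]
  have "openin (subtopology X U) {x \<in> topspace (subtopology X U). f x \<in> S}"
    using c(5) assms(2) by (intro openin_continuous_map_preimage) auto
  moreover have "topspace (subtopology X U) = U"
    using c(2) by auto
  ultimately show ?thesis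
    using openin_trans_full c(1) by metis
qed

text \<open>Read in a chart, \<open>h\<close> becomes an injective continuous map between planar
  sets, so invariance of domain applies. The image is open in the plane, not merely in the
  half-plane; this is what later excludes boundary points.\<close>

lemma planar_chart_image:
  fixes W :: "complex set"
  assumes c: "surface_chart X (U, f)" and "open W"
    and h: "continuous_map (top_of_set W) X h" and inj: "inj_on h W"
  shows "open (f ` (h ` W \<inter> U))"
proof -
  note c' = surface_chartD[OF c]
  define W' where "W' = {w \<in> W. h w \<in> U}"
  have "openin (top_of_set W) W'"
    using openin_continuous_map_preimage[OF h c'(1)] by (simp add: W'_def)
  then have W': "open W'"
    using \<open>open W\<close> openin_open_trans by blast
  have "continuous_map (top_of_set W') X h"
    using h by (rule continuous_map_from_subtopology_mono[of "euclidean" W, simplified])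
      (auto simp: W'_def)
  then have "continuous_map (top_of_set W') (subtopology X U) h"
    by (auto simp: continuous_map_in_subtopology W'_def)
  then have "continuous_map (top_of_set W') euclidean (f \<circ> h)"
    using c'(5) by (rule continuous_map_compose)
  then have "continuous_on W' (f \<circ> h)"
    by simp
  moreover have "inj_on (f \<circ> h) W'"
    using inj c'(3) by (auto simp: inj_on_def W'_def)
  ultimately have "open ((f \<circ> h) ` W')"
    using W' by (intro invariance_of_domain)
  moreover have "(f \<circ> h) ` W' = f ` (h ` W \<inter> U)"
    by (auto simp: W'_def)
  ultimately show ?thesis
    by simp
qed

lemma planar_image_open:
  fixes W :: "complex set"
  assumes X: "oriented_surface X \<A>" and "open W"
    and h: "continuous_map (top_of_set W) X h" and inj: "inj_on h W"
  shows "openin X (h ` W)"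
proof (subst openin_subopen, intro ballI)
  fix x assume x: "x \<in> h ` W"
  then have "x \<in> topspace X"
    using h by (auto simp: continuous_map_def)
  then obtain U f where Uf: "(U, f) \<in> \<A>" "x \<in> U"
    using oriented_surface_cover[OF X] by metis
  note c = oriented_surface_chart[OF X Uf(1)]
  let ?T = "{y \<in> U. f y \<in> f ` (h ` W \<inter> U)}"
  have "openin X ?T"
    using c planar_chart_image[OF c assms(2-4)] by (rule surface_chart_preimage_open)
  moreover have "?T \<subseteq> h ` W"
    using surface_chartD(3)[OF c] by (auto dest: inj_onD)
  moreover have "x \<in> ?T"
    using x Uf by blast
  ultimately show "\<exists>T. openin X T \<and> x \<in> T \<and> T \<subseteq> h ` W"
    by blast
qed

lemma planar_image_interior:
  fixes W :: "complex set"
  assumes X: "oriented_surface X \<A>" and "open W"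
    and h: "continuous_map (top_of_set W) X h" and inj: "inj_on h W"
  shows "h ` W \<inter> surface_boundary \<A> = {}"
proof (rule ccontr)
  assume "h ` W \<inter> surface_boundary \<A> \<noteq> {}"
  then obtain x U f where x: "x \<in> h ` W" "(U, f) \<in> \<A>" "x \<in> U" "Im (f x) = 0"
    by (auto simp: surface_boundary_def)
  note c = oriented_surface_chart[OF X x(2)]
  have "open (f ` (h ` W \<inter> U))"
    using planar_chart_image[OF c assms(2-4)] .
  moreover have "f x \<in> f ` (h ` W \<inter> U)"
    using x by blast
  ultimately obtain e where e: "e > 0" "ball (f x) e \<subseteq> f ` (h ` W \<inter> U)"
    using open_contains_ball by metis
  \<comment> \<open>A point straight below \<open>f x\<close> would be a chart value outside the
    closed half-plane.\<close>
  have "f x - \<i> * of_real (e / 2) \<in> ball (f x) e"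
    using e(1) by (simp add: dist_norm norm_mult)
  then have "f x - \<i> * of_real (e / 2) \<in> closed_half_plane"
    using e(2) surface_chartD(4)[OF c] by blast
  then show False
    using x(4) e(1) by simp
qed

lemma interior_chart_open:
  assumes "surface_chart X (U, f)"
  shows "open (f ` U \<inter> {z. Im z > 0})"
proof -
  obtain T where T: "open T" "f ` U = closed_half_plane \<inter> T"
    using assms by (auto simp: surface_chart_def openin_open)
  then have "f ` U \<inter> {z. Im z > 0} = T \<inter> {z. Im z > 0}"
    by auto
  then show ?thesis
    using T(1) by (simp add: open_Int open_halfspace_Im_gt)
qed

text \<open>The boundary only asks for some chart with imaginary part 0. If the given chart had a
  positive one at \<open>x\<close>, its restriction to the open half-plane would parametrize a
  neighbourhood of \<open>x\<close> by an open planar set, which contains no boundary point.\<close>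

lemma boundary_chart:
  assumes X: "oriented_surface X \<A>" and Uf: "(U, f) \<in> \<A>" "x \<in> U"
    and bd: "x \<in> surface_boundary \<A>"
  shows "Im (f x) = 0"
proof (rule ccontr)
  assume nz: "Im (f x) \<noteq> 0"
  note c = oriented_surface_chart[OF X Uf(1)]
  note c' = surface_chartD[OF c]
  let ?W = "f ` U \<inter> {z. Im z > 0}"
  have "continuous_map (top_of_set ?W) X (inv_into U f)"
    using c'(6) by (rule continuous_map_from_subtopology_mono[of "euclidean" "f ` U", simplified]) auto
  moreover have "inj_on (inv_into U f) ?W"
    by (metis inj_on_inv_into inf_le1)
  ultimately have "inv_into U f ` ?W \<inter> surface_boundary \<A> = {}"
    using planar_image_interior[OF X interior_chart_open[OF c]] by blast
  moreover have "f x \<in> ?W"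
    using nz Uf(2) c'(4) by (auto simp: image_subset_iff less_le)
  then have "x \<in> inv_into U f ` ?W"
    using c'(3) Uf(2) by (metis imageI inv_into_f_f)
  ultimately show False
    using bd by blast
qed

lemma surface_boundary_subset:
  assumes "oriented_surface X \<A>"
  shows "surface_boundary \<A> \<subseteq> topspace X"
proof
  fix x assume "x \<in> surface_boundary \<A>"
  then obtain U f where "(U, f) \<in> \<A>" "x \<in> U"
    by (auto simp: surface_boundary_def)
  then show "x \<in> topspace X"
    using surface_chartD(2)[OF oriented_surface_chart[OF assms]] by blast
qed

text \<open>A short horizontal interval starting at \<open>f a\<close> consists of chart values of
  boundary points in \<open>N\<close>.\<close>

lemma boundary_point_not_isolated:
  assumes X: "oriented_surface X \<A>" and a: "a \<in> surface_boundary \<A>"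
    and N: "openin X N" "a \<in> N"
  shows "infinite (N \<inter> surface_boundary \<A>)"
proof -
  obtain U f where Uf: "(U, f) \<in> \<A>" "a \<in> U" "Im (f a) = 0"
    using a by (auto simp: surface_boundary_def)
  note c = oriented_surface_chart[OF X Uf(1)]
  have "openin (top_of_set closed_half_plane) (f ` (U \<inter> N))"
    using surface_chartD(1)[OF c] N(1) by (intro surface_chart_image_open[OF c]) auto
  then obtain T where T: "open T" "f ` (U \<inter> N) = closed_half_plane \<inter> T"
    by (auto simp: openin_open)
  then have "f a \<in> T"
    using Uf N(2) by blast
  then obtain e where e: "e > 0" "ball (f a) e \<subseteq> T"
    using T(1) open_contains_ball by metis
  have "(\<lambda>t. f a + of_real t) ` {0<..<e} \<subseteq> f ` (N \<inter> surface_boundary \<A>)"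
  proof
    fix z assume "z \<in> (\<lambda>t. f a + of_real t) ` {0<..<e}"
    then obtain t where t: "0 < t" "t < e" "z = f a + of_real t"
      by auto
    then have "z \<in> ball (f a) e"
      by (simp add: dist_norm)
    then have "z \<in> f ` (U \<inter> N)"
      unfolding T(2) using e(2) t Uf(3) by (intro IntI) (simp, blast)
    then obtain x where x: "x \<in> U" "x \<in> N" "z = f x"
      by blast
    then have "Im (f x) = 0"
      using t(3) Uf(3) by (simp flip: x(3))
    then show "z \<in> f ` (N \<inter> surface_boundary \<A>)"
      using x Uf(1) by (auto simp: surface_boundary_def)
  qed
  moreover have "infinite ((\<lambda>t. f a + of_real t) ` {0<..<e})"
    using infinite_Ioo[OF e(1)] by (subst finite_image_iff) (simp_all add: inj_on_def)
  ultimately show ?thesis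
    by (meson finite_imageI finite_subset)
qed


section \<open>Boundary curves in a chart\<close>

text \<open>On the boundary a chart is determined by its real part, so the intermediate value
  theorem for this one real function is enough.\<close>

lemma boundary_curve_covers:
  fixes \<gamma> :: "real \<Rightarrow> 'a"
  assumes c: "surface_chart X (U, f)"
    and \<gamma>: "continuous_map (top_of_set {a..b}) X \<gamma>" "\<gamma> ` {a..b} \<subseteq> U" "a \<le> b"
    and bd: "\<And>t. t \<in> {a..b} \<Longrightarrow> Im (f (\<gamma> t)) = 0"
    and y: "y \<in> U" "Im (f y) = 0" "Re (f (\<gamma> a)) \<le> Re (f y)" "Re (f y) \<le> Re (f (\<gamma> b))"
  shows "y \<in> \<gamma> ` {a..b}"
proof -
  note c' = surface_chartD[OF c]
  have "continuous_map (top_of_set {a..b}) (subtopology X U) \<gamma>"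
    using \<gamma> by (auto simp: continuous_map_in_subtopology)
  then have "continuous_map (top_of_set {a..b}) euclidean (f \<circ> \<gamma>)"
    using c'(5) by (rule continuous_map_compose)
  then have "continuous_on {a..b} (\<lambda>t. Re (f (\<gamma> t)))"
    by (auto intro!: continuous_intros simp: o_def)
  then obtain t where t: "t \<in> {a..b}" "Re (f (\<gamma> t)) = Re (f y)"
    using IVT'[of "\<lambda>t. Re (f (\<gamma> t))" a "Re (f y)" b] y \<gamma>(3) by auto
  then have "f (\<gamma> t) = f y"
    using bd y(2) by (simp add: complex_eq_iff)
  then have "\<gamma> t = y"
    using c'(3) \<gamma>(2) t(1) y(1) by (meson imageI inj_onD subsetD)
  then show ?thesis
    using t(1) by blast
qed

lemma boundary_oriented_near:
  assumes X: "oriented_surface X \<A>" and Uf: "(U, f) \<in> \<A>"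
    and \<gamma>: "continuous_map (top_of_set {0..1}) X \<gamma>" "boundary_oriented \<A> \<gamma>"
    and t: "t \<in> {0..1}" "\<gamma> t \<in> U"
  obtains e where "e > 0" "\<gamma> ` {s \<in> {0..1}. \<bar>s - t\<bar> < e} \<subseteq> U"
    "strict_mono_on {s \<in> {0..1}. \<bar>s - t\<bar> < e} (\<lambda>s. Re (f (\<gamma> s)))"
proof -
  obtain d where d: "d > 0" "strict_mono_on {s \<in> {0..1}. \<bar>s - t\<bar> < d} (\<lambda>s. Re (f (\<gamma> s)))"
    using \<gamma>(2) Uf t unfolding boundary_oriented_def by fast
  have "openin (top_of_set {0..1}) {s \<in> {0..1}. \<gamma> s \<in> U}"
    using openin_continuous_map_preimage[OF \<gamma>(1)
        surface_chartD(1)[OF oriented_surface_chart[OF X Uf]]] by simp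
  then obtain d' where d': "d' > 0" "\<forall>s\<in>{0..1}. dist s t < d' \<longrightarrow> s \<in> {s \<in> {0..1}. \<gamma> s \<in> U}"
    using t by (auto simp: openin_euclidean_subtopology_iff)
  show ?thesis
  proof (rule that)
    show "min d d' > 0"
      using d d' by simp
    show "\<gamma> ` {s \<in> {0..1}. \<bar>s - t\<bar> < min d d'} \<subseteq> U"
      using d'(2) by (auto simp: dist_real_def)
    show "strict_mono_on {s \<in> {0..1}. \<bar>s - t\<bar> < min d d'} (\<lambda>s. Re (f (\<gamma> s)))"
      using d(2) by (rule monotone_on_subset) auto
  qed
qed

text \<open>Next to its start the curve fills the boundary on the right-hand side. The filled
  interval is described in chart coordinates so that two curves meeting in one chart can be
  compared; the next lemma is the counterpart on the left.\<close>

lemma boundary_oriented_initial: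
  assumes X: "oriented_surface X \<A>" and Uf: "(U, f) \<in> \<A>"
    and \<gamma>: "continuous_map (top_of_set {0..1}) X \<gamma>" "boundary_oriented \<A> \<gamma>"
      "\<gamma> ` {0..1} \<subseteq> surface_boundary \<A>"
    and "\<gamma> 0 \<in> U"
  shows "\<exists>s\<in>{0<..<1}. \<gamma> s \<in> U \<and> Re (f (\<gamma> 0)) < Re (f (\<gamma> s)) \<and>
    (\<forall>y\<in>U. Im (f y) = 0 \<and> Re (f (\<gamma> 0)) \<le> Re (f y) \<and> Re (f y) \<le> Re (f (\<gamma> s)) \<longrightarrow> y \<in> \<gamma> ` {0..1})"
proof -
  obtain e where e: "e > 0" "\<gamma> ` {s \<in> {0..1}. \<bar>s - 0\<bar> < e} \<subseteq> U"
    "strict_mono_on {s \<in> {0..1}. \<bar>s - 0\<bar> < e} (\<lambda>s. Re (f (\<gamma> s)))"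
    by (rule boundary_oriented_near[OF X Uf \<gamma>(1,2) _ assms(6)]) (simp, rule that)
  \<comment> \<open>Half of the minimum is strictly below both \<open>e\<close> and 1: the piece
    \<open>{0..s}\<close> stays in the chart, and \<open>s\<close> is an inner parameter.\<close>
  define s where "s = min e 1 / 2"
  have s: "0 < s" "s < 1" "s < e"
    using e(1) by (auto simp: s_def)
  have sub: "\<gamma> ` {0..s} \<subseteq> U"
    using e(2) s by (force simp: image_subset_iff)
  have cont: "continuous_map (top_of_set {0..s}) X \<gamma>"
    using \<gamma>(1) by (rule continuous_map_from_subtopology_mono[of "euclidean" "{0..1}", simplified]) (use s in auto)
  have bd: "Im (f (\<gamma> t)) = 0" if "t \<in> {0..s}" for t
    using that s sub \<gamma>(3) by (intro boundary_chart[OF X Uf]) (auto simp: image_subset_iff)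
  have "Re (f (\<gamma> 0)) < Re (f (\<gamma> s))"
    using e(3) s by (auto simp: monotone_on_def)
  moreover have "\<gamma> ` {0..s} \<subseteq> \<gamma> ` {0..1}"
    using s by auto
  ultimately show ?thesis
    using boundary_curve_covers[OF oriented_surface_chart[OF X Uf] cont sub] bd s sub
    by (intro bexI[of _ s]) (auto simp: subset_iff)
qed

lemma boundary_oriented_final:
  assumes X: "oriented_surface X \<A>" and Uf: "(U, f) \<in> \<A>"
    and \<gamma>: "continuous_map (top_of_set {0..1}) X \<gamma>" "boundary_oriented \<A> \<gamma>"
      "\<gamma> ` {0..1} \<subseteq> surface_boundary \<A>"
    and "\<gamma> 1 \<in> U"
  shows "\<exists>s\<in>{0<..<1}. \<gamma> s \<in> U \<and> Re (f (\<gamma> s)) < Re (f (\<gamma> 1)) \<and>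
    (\<forall>y\<in>U. Im (f y) = 0 \<and> Re (f (\<gamma> s)) \<le> Re (f y) \<and> Re (f y) \<le> Re (f (\<gamma> 1)) \<longrightarrow> y \<in> \<gamma> ` {0..1})"
proof -
  obtain e where e: "e > 0" "\<gamma> ` {s \<in> {0..1}. \<bar>s - 1\<bar> < e} \<subseteq> U"
    "strict_mono_on {s \<in> {0..1}. \<bar>s - 1\<bar> < e} (\<lambda>s. Re (f (\<gamma> s)))"
    by (rule boundary_oriented_near[OF X Uf \<gamma>(1,2) _ assms(6)]) (simp, rule that)
  define s where "s = 1 - min e 1 / 2"
  have s: "0 < s" "s < 1" "1 - s < e"
    using e(1) by (auto simp: s_def min_def field_simps)
  have sub: "\<gamma> ` {s..1} \<subseteq> U"
    using e(2) s by (force simp: image_subset_iff)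
  have cont: "continuous_map (top_of_set {s..1}) X \<gamma>"
    using \<gamma>(1) by (rule continuous_map_from_subtopology_mono[of "euclidean" "{0..1}", simplified]) (use s in auto)
  have bd: "Im (f (\<gamma> t)) = 0" if "t \<in> {s..1}" for t
    using that s sub \<gamma>(3) by (intro boundary_chart[OF X Uf]) (auto simp: image_subset_iff)
  have "Re (f (\<gamma> s)) < Re (f (\<gamma> 1))"
    using e s by (auto simp: monotone_on_def)
  moreover have "\<gamma> ` {s..1} \<subseteq> \<gamma> ` {0..1}"
    using s by auto
  ultimately show ?thesis
    using boundary_curve_covers[OF oriented_surface_chart[OF X Uf] cont sub] bd s sub
    by (intro bexI[of _ s]) (auto simp: subset_iff)
qed


section \<open>The folded segments of a cut surface\<close>

text \<open>The only properties of the triangulation that matter: the folded sides are disjoint except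
  at their ends, and each joins its puncture to a marked point on the boundary.\<close>

locale folded_cut =
  fixes X :: "'a topology" and \<A> :: "'a chart set" and M \<P> :: "'a set"
    and i :: "'a \<Rightarrow> real \<Rightarrow> 'a"
    and Y :: "'b topology" and \<B> :: "'b chart set" and \<pi> :: "'b \<Rightarrow> 'a"
    and E :: "'a \<Rightarrow> 'b set" and \<phi> :: "'a \<Rightarrow> 'b \<Rightarrow> real"
  assumes surface_X: "oriented_surface X \<A>"
    and finite_M: "finite M"
    and M_boundary: "M \<subseteq> surface_boundary \<A>"
    and punctures_interior: "\<P> \<inter> surface_boundary \<A> = {}"
    and cut: "cut_surface X \<A> \<P> i Y \<B> \<pi> E \<phi>"
    and side_avoids: "P \<in> \<P> \<Longrightarrow> i P ` {0<..<1} \<inter> (\<P> \<union> surface_boundary \<A>) = {}"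
    and sides_disjoint: "P \<in> \<P> \<Longrightarrow> Q \<in> \<P> \<Longrightarrow> P \<noteq> Q \<Longrightarrow> i P ` {0<..<1} \<inter> i Q ` {0<..<1} = {}"
    and side_ends: "P \<in> \<P> \<Longrightarrow> \<exists>a\<in>M. {i P 0, i P 1} = {a, P}"
begin

abbreviation seg :: "'a \<Rightarrow> real \<Rightarrow> 'b" where
  "seg \<equiv> seg_point E \<phi>"

section \<open>Parametrization of the segments and of the two kinds of gluing steps\<close>

lemma surface_Y: "oriented_surface Y \<B>"
  using cut by (simp add: cut_surface_def)

lemma E_boundary: "P \<in> \<P> \<Longrightarrow> E P \<subseteq> surface_boundary \<B>"
  using cut by (simp add: cut_surface_def)

lemma E_topspace: "P \<in> \<P> \<Longrightarrow> E P \<subseteq> topspace Y"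
  using E_boundary surface_boundary_subset[OF surface_Y] by blast

lemma \<phi>_homeo: "P \<in> \<P> \<Longrightarrow> homeomorphic_map (subtopology Y (E P)) (top_of_set {0..1}) (\<phi> P)"
  using cut by (simp add: cut_surface_def)

lemma \<phi>_bij:
  assumes "P \<in> \<P>"
  shows "bij_betw (\<phi> P) (E P) {0..1}"
  using homeomorphic_imp_injective_map[OF \<phi>_homeo[OF assms]]
    homeomorphic_imp_surjective_map[OF \<phi>_homeo[OF assms]] E_topspace[OF assms]
  by (simp add: bij_betw_def inf.absorb2)

lemma seg_mem: "P \<in> \<P> \<Longrightarrow> t \<in> {0..1} \<Longrightarrow> seg P t \<in> E P"
  unfolding seg_point_def using \<phi>_bij by (metis bij_betw_def inv_into_into)

lemma \<phi>_seg: "P \<in> \<P> \<Longrightarrow> t \<in> {0..1} \<Longrightarrow> \<phi> P (seg P t) = t"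
  unfolding seg_point_def using \<phi>_bij by (metis bij_betw_def f_inv_into_f)

lemma seg_topspace: "P \<in> \<P> \<Longrightarrow> t \<in> {0..1} \<Longrightarrow> seg P t \<in> topspace Y"
  using seg_mem E_topspace by blast

lemma seg_inject: "P \<in> \<P> \<Longrightarrow> s \<in> {0..1} \<Longrightarrow> t \<in> {0..1} \<Longrightarrow> seg P s = seg P t \<longleftrightarrow> s = t"
  using \<phi>_seg by metis

lemma mem_E_iff: "P \<in> \<P> \<Longrightarrow> x \<in> E P \<longleftrightarrow> (\<exists>t\<in>{0..1}. x = seg P t)"
  unfolding seg_point_def using \<phi>_bij
  by (metis bij_betw_def bij_betw_apply inv_into_f_f inv_into_into)

lemma seg_image: "P \<in> \<P> \<Longrightarrow> seg P ` {0..1} = E P"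
  using mem_E_iff by blast

lemma seg_continuous:
  assumes "P \<in> \<P>"
  shows "continuous_map (top_of_set {0..1}) Y (seg P)"
proof -
  have "topspace (subtopology Y (E P)) = E P"
    using E_topspace[OF assms] by auto
  then show ?thesis
    using continuous_map_inv_into[OF \<phi>_homeo[OF assms]]
    unfolding seg_point_def by (simp add: continuous_map_in_subtopology)
qed

lemma seg_oriented: "P \<in> \<P> \<Longrightarrow> boundary_oriented \<B> (seg P)"
  using cut by (simp add: cut_surface_def)

lemma fold_step_iff:
  "fold_step \<P> E \<phi> x y \<longleftrightarrow> (\<exists>P\<in>\<P>. \<exists>t\<in>{0..1}. x = seg P t \<and> y = seg P (1 - t))"
  unfolding fold_step_def using mem_E_iff \<phi>_seg by metis

lemma fold_step_sym: "fold_step \<P> E \<phi> x y \<Longrightarrow> fold_step \<P> E \<phi> y x"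
  unfolding fold_step_iff by force

lemma Psi_step_iff:
  "Psi_step \<P> E \<phi> u w \<longleftrightarrow>
     (\<exists>P\<in>\<P>. \<exists>t\<in>{0..1}. u = (True, seg P t) \<and> w = (False, seg P (1 - t)))"
proof
  assume "Psi_step \<P> E \<phi> u w"
  then obtain P x where P: "P \<in> \<P>" "x \<in> E P" "u = (True, x)"
    "w = (False, seg P (1 - \<phi> P x))"
    by (auto simp: Psi_step_def Psi_def swap_copies_def)
  then obtain t where "t \<in> {0..1}" "x = seg P t"
    using mem_E_iff by blast
  then show "\<exists>P\<in>\<P>. \<exists>t\<in>{0..1}. u = (True, seg P t) \<and> w = (False, seg P (1 - t))"
    using P \<phi>_seg by metis
next
  assume "\<exists>P\<in>\<P>. \<exists>t\<in>{0..1}. u = (True, seg P t) \<and> w = (False, seg P (1 - t))"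
  then obtain P t where P: "P \<in> \<P>" "t \<in> {0..1}" "u = (True, seg P t)" "w = (False, seg P (1 - t))"
    by blast
  then have "u \<in> {True} \<times> E P" "w = Psi E \<phi> P u"
    using seg_mem \<phi>_seg by (simp_all add: Psi_def swap_copies_def)
  then show "Psi_step \<P> E \<phi> u w"
    using P(1) unfolding Psi_step_def by blast
qed

section \<open>Position of the segments and their images relative to the boundary\<close>

lemma \<pi>_eq_iff:
  "x \<in> topspace Y \<Longrightarrow> y \<in> topspace Y \<Longrightarrow> \<pi> x = \<pi> y \<longleftrightarrow> equivclp (fold_step \<P> E \<phi>) x y"
  using cut by (simp add: cut_surface_def)

lemma \<pi>_quotient: "quotient_map Y X \<pi>"
  using cut by (simp add: cut_surface_def)

lemma \<pi>_continuous: "continuous_map Y X \<pi>"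
  using \<pi>_quotient by (rule quotient_imp_continuous_map)

lemma \<pi>_seg_reflect:
  assumes "P \<in> \<P>" "t \<in> {0..1}"
  shows "\<pi> (seg P (1 - t)) = \<pi> (seg P t)"
proof -
  have "fold_step \<P> E \<phi> (seg P t) (seg P (1 - t))"
    using assms fold_step_iff by blast
  then have "equivclp (fold_step \<P> E \<phi>) (seg P t) (seg P (1 - t))"
    by (rule r_into_equivclp)
  moreover have "1 - t \<in> {0..1}"
    using assms(2) by auto
  ultimately show ?thesis
    using \<pi>_eq_iff[OF seg_topspace seg_topspace] assms by metis
qed

lemma side_end_cases:
  assumes "P \<in> \<P>" "s \<in> {0..1}" and "i P s \<notin> i P ` {0<..<1}"
  shows "i P s \<in> insert P M"
proof -
  have "s \<in> {0, 1}"
    using assms(2,3) by (metis atLeastAtMost_iff greaterThanLessThan_iff image_eqI insert_iff less_eq_real_def)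
  then have "i P s \<in> {i P 0, i P 1}"
    by auto
  moreover obtain a where "a \<in> M" "{i P 0, i P 1} = {a, P}"
    using side_ends[OF assms(1)] by blast
  ultimately show ?thesis
    by (metis empty_iff insert_iff)
qed

lemma \<pi>_seg_side:
  assumes "P \<in> \<P>" "t \<in> {0..1}"
  shows "\<pi> (seg P t) \<in> i P ` {0..1}"
proof -
  have half: "(\<pi> \<circ> seg P) ` {0..1/2} = i P ` {0..1}"
    using cut assms(1) by (simp add: cut_surface_def)
  show ?thesis
  proof (cases "t \<le> 1/2")
    case True
    then show ?thesis
      using half assms(2) by fastforce
  next
    case False
    then have "1 - t \<in> {0..1/2}"
      using assms(2) by auto
    then have "\<pi> (seg P (1 - t)) \<in> i P ` {0..1}"
      using half by (metis comp_apply imageI)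
    then show ?thesis
      using \<pi>_seg_reflect[OF assms] by simp
  qed
qed

lemma \<pi>_seg_0: "P \<in> \<P> \<Longrightarrow> \<pi> (seg P 0) \<in> M"
proof -
  assume P: "P \<in> \<P>"
  then have "{\<pi> (seg P 0), P} = {i P 0, i P 1}"
    using cut by (simp add: cut_surface_def)
  then obtain a where "a \<in> M" "{\<pi> (seg P 0), P} = {a, P}"
    using side_ends[OF P] by metis
  then show ?thesis
    using P punctures_interior M_boundary by (metis disjoint_iff doubleton_eq_iff subset_iff)
qed

lemma \<pi>_seg_1: "P \<in> \<P> \<Longrightarrow> \<pi> (seg P 1) = \<pi> (seg P 0)"
  using \<pi>_seg_reflect[of P 0] by simp

lemma \<pi>_seg_boundary_half:
  assumes P: "P \<in> \<P>" and t: "t \<in> {0..1/2}" and bd: "\<pi> (seg P t) \<in> surface_boundary \<A>"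
  shows "t = 0"
proof -
  obtain s where s: "s \<in> {0..1}" "\<pi> (seg P t) = i P s"
    using \<pi>_seg_side[OF P, of t] t by auto
  have "{\<pi> (seg P 0), P} = {i P 0, i P 1}"
    using cut P by (simp add: cut_surface_def)
  moreover have "s \<in> {0, 1}"
    using side_avoids[OF P] s bd
    by (metis Int_iff UnI2 atLeastAtMost_iff empty_iff greaterThanLessThan_iff image_eqI insert_iff
        less_eq_real_def)
  ultimately have "i P s \<in> {\<pi> (seg P 0), P}"
    by auto
  moreover have "i P s \<noteq> P"
    using s(2) bd P punctures_interior by auto
  ultimately have "\<pi> (seg P t) = \<pi> (seg P 0)"
    using s(2) by auto
  moreover have "inj_on (\<pi> \<circ> seg P) {0..1/2}"
    using cut P by (simp add: cut_surface_def)
  ultimately show ?thesis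
    using t inj_onD[of "\<pi> \<circ> seg P" "{0..1/2}" t 0] by simp
qed

text \<open>Because of this, a fold step over a marked point always joins the two ends of one
  segment, so such fibres are governed by a graph on segment ends.\<close>

lemma \<pi>_seg_boundary_iff:
  assumes P: "P \<in> \<P>" and t: "t \<in> {0..1}"
  shows "\<pi> (seg P t) \<in> surface_boundary \<A> \<longleftrightarrow> t = 0 \<or> t = 1"
proof
  assume bd: "\<pi> (seg P t) \<in> surface_boundary \<A>"
  show "t = 0 \<or> t = 1"
  proof (cases "t \<le> 1/2")
    case True
    then show ?thesis
      using \<pi>_seg_boundary_half[OF P _ bd] t by simp
  next
    case False
    then have "1 - t = 0"
      using bd \<pi>_seg_reflect[OF P t] t by (intro \<pi>_seg_boundary_half[OF P]) auto
    then show ?thesis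
      by simp
  qed
next
  assume "t = 0 \<or> t = 1"
  then show "\<pi> (seg P t) \<in> surface_boundary \<A>"
    using \<pi>_seg_0[OF P] \<pi>_seg_1[OF P] M_boundary by auto
qed

text \<open>Over an inner parameter the image in \<open>X\<close> is off the boundary, hence an
  inner point of the folded side or its puncture; neither can belong to two different punctures.
  Ends are left out because consecutive segments share them.\<close>

lemma segments_disjoint:
  assumes P: "P \<in> \<P>" and Q: "Q \<in> \<P>" "P \<noteq> Q" and t: "t \<in> {0<..<1}"
  shows "seg P t \<notin> E Q"
proof
  assume "seg P t \<in> E Q"
  then obtain t' where t': "t' \<in> {0..1}" "seg P t = seg Q t'"
    using mem_E_iff Q by blast
  define x where "x = \<pi> (seg P t)"
  have t01: "t \<in> {0..1}"
    using t by auto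
  have nb: "x \<notin> surface_boundary \<A>"
    using \<pi>_seg_boundary_iff[OF P t01] t by (simp add: x_def)
  obtain s where s: "s \<in> {0..1}" "x = i P s"
    using \<pi>_seg_side[OF P t01] by (auto simp: x_def)
  obtain s' where s': "s' \<in> {0..1}" "x = i Q s'"
    using \<pi>_seg_side[OF Q(1) t'(1)] t'(2) by (auto simp: x_def)
  have "x \<in> i P ` {0<..<1} \<or> x = P" "x \<in> i Q ` {0<..<1} \<or> x = Q"
    using side_end_cases[OF P s(1)] side_end_cases[OF Q(1) s'(1)] s(2) s'(2) nb M_boundary
    by auto
  then show False
    using sides_disjoint[OF P Q] side_avoids[OF P] side_avoids[OF Q(1)] P Q by blast
qed

lemma \<pi>_inj_off_segments:
  assumes "x \<in> topspace Y" "y \<in> topspace Y" "\<pi> x = \<pi> y" and x: "x \<notin> (\<Union>P\<in>\<P>. E P)"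
  shows "x = y"
proof -
  have "equivclp (fold_step \<P> E \<phi>) x y"
    using assms \<pi>_eq_iff by blast
  then have "x \<in> {x} \<longleftrightarrow> y \<in> {x}"
  proof (rule equivclp_invariant)
    fix u v assume "fold_step \<P> E \<phi> u v"
    then have "u \<in> (\<Union>P\<in>\<P>. E P)" "v \<in> (\<Union>P\<in>\<P>. E P)"
      using fold_step_sym by (auto simp: fold_step_def)
    then show "u \<in> {x} \<longleftrightarrow> v \<in> {x}"
      using x by blast
  qed
  then show ?thesis
    by simp
qed

text \<open>Segments lie in the boundary of \<open>Y\<close>, so near an interior point
  \<open>\<pi>\<close> is injective. Composed with an inverse chart it is an injective planar
  parametrization in \<open>X\<close>, and its image misses the boundary of
  \<open>X\<close>.\<close>

lemma boundary_of_\<pi>_boundary: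
  assumes y: "y \<in> topspace Y" and bd: "\<pi> y \<in> surface_boundary \<A>"
  shows "y \<in> surface_boundary \<B>"
proof (rule ccontr)
  assume nb: "y \<notin> surface_boundary \<B>"
  obtain V g where Vg: "(V, g) \<in> \<B>" "y \<in> V"
    using oriented_surface_cover[OF surface_Y y] by metis
  note c = oriented_surface_chart[OF surface_Y Vg(1)]
  note c' = surface_chartD[OF c]
  let ?W = "g ` V \<inter> {z. Im z > 0}"
  let ?k = "inv_into V g"
  have "g y \<in> closed_half_plane"
    using c'(4) Vg(2) by blast
  moreover have "Im (g y) \<noteq> 0"
    using nb Vg by (auto simp: surface_boundary_def)
  ultimately have gy: "g y \<in> ?W"
    using Vg(2) by auto
  have W: "open ?W"
    using interior_chart_open[OF c] .
  have k: "continuous_map (top_of_set ?W) Y ?k"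
    using c'(6) by (rule continuous_map_from_subtopology_mono[of "euclidean" "g ` V", simplified]) auto
  have kinj: "inj_on ?k ?W"
    by (metis inj_on_inv_into inf_le1)
  have off: "?k ` ?W \<inter> (\<Union>P\<in>\<P>. E P) = {}"
    using planar_image_interior[OF surface_Y W k kinj] E_boundary by blast
  have sub: "?k ` ?W \<subseteq> topspace Y"
    using k by (auto simp: continuous_map_def)
  have "inj_on \<pi> (?k ` ?W)"
    using \<pi>_inj_off_segments off sub by (intro inj_onI) blast
  then have "inj_on (\<pi> \<circ> ?k) ?W"
    using kinj by (rule comp_inj_on[rotated])
  then have "(\<pi> \<circ> ?k) ` ?W \<inter> surface_boundary \<A> = {}"
    using planar_image_interior[OF surface_X W] continuous_map_compose[OF k \<pi>_continuous] by blast
  moreover have "(\<pi> \<circ> ?k) (g y) = \<pi> y"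
    using c'(3) Vg(2) by simp
  ultimately show False
    using gy bd by (metis IntI empty_iff imageI)
qed

text \<open>Both segments leave the common point towards increasing real part in one chart, so the
  shorter initial piece lies in the other segment, against disjointness at inner parameters.
  Together with the same fact at final ends this gives determinism of the edge relation in both
  directions.\<close>

lemma segments_meeting_at_start:
  assumes P: "P \<in> \<P>" and Q: "Q \<in> \<P>" and eq: "seg P 0 = seg Q 0"
  shows "P = Q"
proof (rule ccontr)
  assume ne: "P \<noteq> Q"
  obtain U f where Uf: "(U, f) \<in> \<B>" "seg P 0 \<in> U"
    using oriented_surface_cover[OF surface_Y seg_topspace[OF P, of 0]] by auto
  have bd: "seg R s \<in> surface_boundary \<B>" if "R \<in> \<P>" "s \<in> {0<..<1}" for R s
    using E_boundary seg_mem[of R s] that by force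
  obtain s where s: "s \<in> {0<..<1}" "seg P s \<in> U" "Re (f (seg P 0)) < Re (f (seg P s))"
    "\<And>y. y \<in> U \<Longrightarrow> Im (f y) = 0 \<Longrightarrow> Re (f (seg P 0)) \<le> Re (f y) \<Longrightarrow>
      Re (f y) \<le> Re (f (seg P s)) \<Longrightarrow> y \<in> E P"
    using boundary_oriented_initial[OF surface_Y Uf(1) seg_continuous[OF P] seg_oriented[OF P]]
      E_boundary[OF P] Uf(2) unfolding seg_image[OF P] by blast
  obtain t where t: "t \<in> {0<..<1}" "seg Q t \<in> U" "Re (f (seg Q 0)) < Re (f (seg Q t))"
    "\<And>y. y \<in> U \<Longrightarrow> Im (f y) = 0 \<Longrightarrow> Re (f (seg Q 0)) \<le> Re (f y) \<Longrightarrow>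
      Re (f y) \<le> Re (f (seg Q t)) \<Longrightarrow> y \<in> E Q"
    using boundary_oriented_initial[OF surface_Y Uf(1) seg_continuous[OF Q] seg_oriented[OF Q]]
      E_boundary[OF Q] Uf(2) eq unfolding seg_image[OF Q] by auto
  have "Im (f (seg P s)) = 0" "Im (f (seg Q t)) = 0"
    using boundary_chart[OF surface_Y Uf(1)] bd P Q s(1,2) t(1,2) by blast+
  then have "seg P s \<in> E Q \<or> seg Q t \<in> E P"
    using s t eq by (metis less_imp_le linear)
  then show False
    using segments_disjoint P Q ne s(1) t(1) by metis
qed

lemma segments_meeting_at_end:
  assumes P: "P \<in> \<P>" and Q: "Q \<in> \<P>" and eq: "seg P 1 = seg Q 1"
  shows "P = Q"
proof (rule ccontr)
  assume ne: "P \<noteq> Q"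
  obtain U f where Uf: "(U, f) \<in> \<B>" "seg P 1 \<in> U"
    using oriented_surface_cover[OF surface_Y seg_topspace[OF P, of 1]] by auto
  have bd: "seg R s \<in> surface_boundary \<B>" if "R \<in> \<P>" "s \<in> {0<..<1}" for R s
    using E_boundary seg_mem[of R s] that by force
  obtain s where s: "s \<in> {0<..<1}" "seg P s \<in> U" "Re (f (seg P s)) < Re (f (seg P 1))"
    "\<And>y. y \<in> U \<Longrightarrow> Im (f y) = 0 \<Longrightarrow> Re (f (seg P s)) \<le> Re (f y) \<Longrightarrow>
      Re (f y) \<le> Re (f (seg P 1)) \<Longrightarrow> y \<in> E P"
    using boundary_oriented_final[OF surface_Y Uf(1) seg_continuous[OF P] seg_oriented[OF P]]
      E_boundary[OF P] Uf(2) unfolding seg_image[OF P] by blast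
  obtain t where t: "t \<in> {0<..<1}" "seg Q t \<in> U" "Re (f (seg Q t)) < Re (f (seg Q 1))"
    "\<And>y. y \<in> U \<Longrightarrow> Im (f y) = 0 \<Longrightarrow> Re (f (seg Q t)) \<le> Re (f y) \<Longrightarrow>
      Re (f y) \<le> Re (f (seg Q 1)) \<Longrightarrow> y \<in> E Q"
    using boundary_oriented_final[OF surface_Y Uf(1) seg_continuous[OF Q] seg_oriented[OF Q]]
      E_boundary[OF Q] Uf(2) eq unfolding seg_image[OF Q] by auto
  have "Im (f (seg P s)) = 0" "Im (f (seg Q t)) = 0"
    using boundary_chart[OF surface_Y Uf(1)] bd P Q s(1,2) t(1,2) by blast+
  then have "seg P s \<in> E Q \<or> seg Q t \<in> E P"
    using s t eq by (metis less_imp_le linear)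
  then show False
    using segments_disjoint P Q ne s(1) t(1) by metis
qed

lemma boundary_near_common_end:
  assumes P: "P \<in> \<P>" and Q: "Q \<in> \<P>" and eq: "seg P 0 = seg Q 1"
  shows "\<exists>N. openin Y N \<and> seg P 0 \<in> N \<and> N \<inter> surface_boundary \<B> \<subseteq> (\<Union>P\<in>\<P>. E P)"
proof -
  obtain U f where Uf: "(U, f) \<in> \<B>" "seg P 0 \<in> U"
    using oriented_surface_cover[OF surface_Y seg_topspace[OF P, of 0]] by auto
  obtain s where s: "s \<in> {0<..<1}" "Re (f (seg P 0)) < Re (f (seg P s))"
    "\<And>y. y \<in> U \<Longrightarrow> Im (f y) = 0 \<Longrightarrow> Re (f (seg P 0)) \<le> Re (f y) \<Longrightarrow>
      Re (f y) \<le> Re (f (seg P s)) \<Longrightarrow> y \<in> E P"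
    using boundary_oriented_initial[OF surface_Y Uf(1) seg_continuous[OF P] seg_oriented[OF P]]
      E_boundary[OF P] Uf(2) unfolding seg_image[OF P] by blast
  obtain t where t: "t \<in> {0<..<1}" "Re (f (seg Q t)) < Re (f (seg Q 1))"
    "\<And>y. y \<in> U \<Longrightarrow> Im (f y) = 0 \<Longrightarrow> Re (f (seg Q t)) \<le> Re (f y) \<Longrightarrow>
      Re (f y) \<le> Re (f (seg Q 1)) \<Longrightarrow> y \<in> E Q"
    using boundary_oriented_final[OF surface_Y Uf(1) seg_continuous[OF Q] seg_oriented[OF Q]]
      E_boundary[OF Q] Uf(2) eq unfolding seg_image[OF Q] by auto
  \<comment> \<open>Inside this vertical strip the boundary to the right of the common end is filled
    by \<open>P\<close> and the boundary to the left by \<open>Q\<close>.\<close>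
  let ?S = "{z. Re (f (seg Q t)) < Re z} \<inter> {z. Re z < Re (f (seg P s))}"
  let ?N = "{y \<in> U. f y \<in> ?S}"
  have "open ?S"
    by (intro open_Int open_halfspace_Re_gt open_halfspace_Re_lt)
  then have "openin Y ?N"
    by (rule surface_chart_preimage_open[OF oriented_surface_chart[OF surface_Y Uf(1)]])
  moreover have "seg P 0 \<in> ?N"
    using Uf(2) s(2) t(2) eq by simp
  moreover have "?N \<inter> surface_boundary \<B> \<subseteq> (\<Union>P\<in>\<P>. E P)"
  proof
    fix y assume y: "y \<in> ?N \<inter> surface_boundary \<B>"
    then have "Im (f y) = 0"
      using boundary_chart[OF surface_Y Uf(1)] by blast
    then have "y \<in> E P \<or> y \<in> E Q"
      using s(3)[of y] t(3)[of y] y eq by force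
    then show "y \<in> (\<Union>P\<in>\<P>. E P)"
      using P Q by blast
  qed
  ultimately show ?thesis
    by blast
qed

text \<open>If the segments closed up around every point over \<open>a\<close>, the boundary of \<open>Y\<close> near the fibre
  of \<open>a\<close> would fold to the interior of \<open>X\<close>, so \<open>a\<close> would be isolated in the boundary of \<open>X\<close>
  up to marked points. This is why no boundary component of \<open>Y\<close> is covered by segments.\<close>

lemma fibre_has_free_end:
  assumes a: "a \<in> M"
  shows "\<exists>v\<in>topspace Y. \<pi> v = a \<and>
    ((\<forall>Q\<in>\<P>. v \<noteq> seg Q 0) \<or> (\<forall>Q\<in>\<P>. v \<noteq> seg Q 1))"
proof (rule ccontr)
  assume "\<not> ?thesis"
  then have both: "(\<exists>Q\<in>\<P>. v = seg Q 0) \<and> (\<exists>Q\<in>\<P>. v = seg Q 1)"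
    if "v \<in> topspace Y" "\<pi> v = a" for v
    using that by blast
  \<comment> \<open>The largest open set whose boundary points all lie on segments; taking the union
    provides one neighbourhood of the whole fibre.\<close>
  define N where "N = \<Union>{N. openin Y N \<and> N \<inter> surface_boundary \<B> \<subseteq> (\<Union>P\<in>\<P>. E P)}"
  have N: "openin Y N" "N \<inter> surface_boundary \<B> \<subseteq> (\<Union>P\<in>\<P>. E P)"
    by (auto simp: N_def)
  have fibre: "v \<in> N" if v: "v \<in> topspace Y" "\<pi> v = a" for v
  proof -
    obtain P Q where "P \<in> \<P>" "v = seg P 0" "Q \<in> \<P>" "v = seg Q 1"
      using both[OF v] by blast
    then show ?thesis
      using boundary_near_common_end[of P Q] unfolding N_def by auto
  qed
  \<comment> \<open>A continuous map from a compact to a Hausdorff space is closed. Hence the points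
    of \<open>X\<close> whose entire fibre lies in \<open>N\<close> form an open set, and it
    contains \<open>a\<close>.\<close>
  have "closed_map Y X \<pi>"
    using continuous_imp_closed_map[OF \<pi>_continuous] cut surface_X
    by (simp add: cut_surface_def oriented_surface_def)
  moreover have "closedin Y (topspace Y - N)"
    using N(1) by blast
  ultimately have "closedin X (\<pi> ` (topspace Y - N))"
    by (simp add: closed_map_def)
  then have "openin X (topspace X - \<pi> ` (topspace Y - N))"
    by blast
  moreover have a_bd: "a \<in> surface_boundary \<A>"
    using a M_boundary by blast
  moreover have "a \<in> topspace X - \<pi> ` (topspace Y - N)"
    using a_bd surface_boundary_subset[OF surface_X] fibre by blast
  ultimately have "infinite ((topspace X - \<pi> ` (topspace Y - N)) \<inter> surface_boundary \<A>)"
    using boundary_point_not_isolated[OF surface_X] by blast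
  \<comment> \<open>As \<open>M\<close> is finite, an unmarked boundary point \<open>x\<close> is
    left over. Its preimage lies on a segment, where only the ends map to the boundary, and these
    map to \<open>M\<close>.\<close>
  then have "\<not> (topspace X - \<pi> ` (topspace Y - N)) \<inter> surface_boundary \<A> \<subseteq> M"
    using finite_M finite_subset by blast
  then obtain x where x: "x \<in> topspace X" "x \<notin> \<pi> ` (topspace Y - N)" "x \<in> surface_boundary \<A>"
    "x \<notin> M"
    by blast
  then obtain y where y: "y \<in> topspace Y" "\<pi> y = x"
    using \<pi>_quotient by (metis imageE quotient_imp_surjective_map)
  then have "y \<in> N" "y \<in> surface_boundary \<B>"
    using x boundary_of_\<pi>_boundary by auto
  then obtain Q where Q: "Q \<in> \<P>" "y \<in> E Q"
    using N(2) by blast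
  then obtain t where t: "t \<in> {0..1}" "y = seg Q t"
    using mem_E_iff by blast
  then have "t = 0 \<or> t = 1"
    using \<pi>_seg_boundary_iff[OF Q(1) t(1)] x(3) y(2) by simp
  then have "x \<in> M"
    using \<pi>_seg_0[OF Q(1)] \<pi>_seg_1[OF Q(1)] t y by auto
  then show False
    using x(4) by blast
qed


section \<open>Fixed points of the exchange of the copies\<close>

text \<open>The relation \<open>r\<close> is to be read as the segments, all oriented one way, as edges between their
  ends. The points over \<open>\<pi> v\<close> then form a directed path ending in \<open>v\<close>, and each gluing step
  exchanges the copies and the parity of the distance to \<open>v\<close>.\<close>

lemma alternating_fibre:
  assumes r: "\<And>y z. r y z \<or> r z y \<longleftrightarrow> (\<exists>Q\<in>\<P>. {y, z} = {seg Q 0, seg Q 1})"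
    and det: "\<And>x y z. r x y \<Longrightarrow> r x z \<Longrightarrow> y = z" and sink: "\<And>y. \<not> r v y"
    and v: "v \<in> topspace Y" "\<pi> v \<in> M"
    and x: "x \<in> topspace Y" "\<pi> x = \<pi> v"
  shows "\<not> equivclp (Psi_step \<P> E \<phi>) (b, x) (\<not> b, x)"
proof -
  have edge: "r (seg Q t) (seg Q (1 - t)) \<or> r (seg Q (1 - t)) (seg Q t)"
    if "Q \<in> \<P>" "t \<in> {0..1}" "\<pi> (seg Q t) = \<pi> v" for Q t
  proof -
    have "t = 0 \<or> t = 1"
      using \<pi>_seg_boundary_iff[OF that(1,2)] that(3) v(2) M_boundary by auto
    then have "{seg Q t, seg Q (1 - t)} = {seg Q 0, seg Q 1}"
      by auto
    then show ?thesis
      using r that(1) by blast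
  qed
  \<comment> \<open>Against an edge this is immediate. Along an edge, the path from \<open>y\<close>
    to \<open>v\<close> is not empty since \<open>v\<close> is a sink, and by determinism it begins
    with that very edge.\<close>
  have reach_step: "r\<^sup>*\<^sup>* z v" if "r\<^sup>*\<^sup>* y v" "r y z \<or> r z y" for y z
    using that(2)
  proof
    assume yz: "r y z"
    show ?thesis
      using that(1)
    proof (cases rule: converse_rtranclpE)
      case base
      then show ?thesis
        using yz sink by blast
    next
      case (step y')
      then show ?thesis
        using det[OF yz] by blast
    qed
  next
    assume "r z y"
    then show ?thesis
      using that(1) by (rule converse_rtranclp_into_rtranclp)
  qed
  have reach: "r\<^sup>*\<^sup>* y v" if y: "y \<in> topspace Y" "\<pi> y = \<pi> v" for y
  proof -
    have "equivclp (fold_step \<P> E \<phi>) v y"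
      using \<pi>_eq_iff y v(1) by metis
    then have "v \<in> {y. \<pi> y = \<pi> v \<and> r\<^sup>*\<^sup>* y v} \<longleftrightarrow> y \<in> {y. \<pi> y = \<pi> v \<and> r\<^sup>*\<^sup>* y v}"
    proof (rule equivclp_invariant)
      fix u w assume "fold_step \<P> E \<phi> u w"
      then obtain Q t where Q: "Q \<in> \<P>" "t \<in> {0..1}" "u = seg Q t" "w = seg Q (1 - t)"
        using fold_step_iff by blast
      then have "\<pi> w = \<pi> u" "\<pi> u = \<pi> v \<Longrightarrow> r u w \<or> r w u"
        using \<pi>_seg_reflect edge by auto
      then show "u \<in> {y. \<pi> y = \<pi> v \<and> r\<^sup>*\<^sup>* y v} \<longleftrightarrow> w \<in> {y. \<pi> y = \<pi> v \<and> r\<^sup>*\<^sup>* y v}"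
        using reach_step by auto
    qed
    then show ?thesis
      by simp
  qed
  have "\<exists>c :: 'b \<Rightarrow> bool. \<forall>y z. r y z \<and> r\<^sup>*\<^sup>* z v \<longrightarrow> c y \<noteq> c z"
    by (rule parity_colouring) (fact det, fact sink)
  then obtain c :: "'b \<Rightarrow> bool" where c: "\<forall>y z. r y z \<and> r\<^sup>*\<^sup>* z v \<longrightarrow> c y \<noteq> c z"
    by (elim exE)
  \<comment> \<open>Tying the tag to the colour leaves exactly one of the two copies of
    \<open>x\<close> in the set. Restricting to the fibre makes steps elsewhere harmless.\<close>
  let ?T = "{(b, y). \<pi> y = \<pi> v \<and> c y = b}"
  show ?thesis
  proof
    assume "equivclp (Psi_step \<P> E \<phi>) (b, x) (\<not> b, x)"
    then have "(b, x) \<in> ?T \<longleftrightarrow> (\<not> b, x) \<in> ?T"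
    proof (rule equivclp_invariant)
      fix u w assume "Psi_step \<P> E \<phi> u w"
      then obtain Q t where Q: "Q \<in> \<P>" "t \<in> {0..1}" "u = (True, seg Q t)" "w = (False, seg Q (1 - t))"
        using Psi_step_iff by blast
      have \<pi>: "\<pi> (seg Q (1 - t)) = \<pi> (seg Q t)"
        using \<pi>_seg_reflect Q by blast
      have "c (seg Q t) \<noteq> c (seg Q (1 - t))" if "\<pi> (seg Q t) = \<pi> v"
      proof -
        have "r\<^sup>*\<^sup>* (seg Q t) v" "r\<^sup>*\<^sup>* (seg Q (1 - t)) v"
          using that \<pi> Q(1,2) by (auto intro!: reach seg_topspace)
        then show ?thesis
          using edge[OF Q(1,2) that] c by metis
      qed
      then show "u \<in> ?T \<longleftrightarrow> w \<in> ?T"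
        using Q(3,4) \<pi> by auto
    qed
    then show False
      using x(2) by auto
  qed
qed

text \<open>The free end may lack an outgoing or an incoming segment; in the second case all edges
  are reversed, so that \<open>v\<close> is a sink both times. Allowing any \<open>x\<close> in the
  fibre covers both ends of the segment of \<open>P\<close>.\<close>

lemma end_not_fixed:
  assumes P: "P \<in> \<P>" and x: "x \<in> topspace Y" "\<pi> x = \<pi> (seg P 0)"
  shows "\<not> equivclp (Psi_step \<P> E \<phi>) (b, x) (\<not> b, x)"
proof -
  obtain v where v: "v \<in> topspace Y" "\<pi> v = \<pi> (seg P 0)"
    "(\<forall>Q\<in>\<P>. v \<noteq> seg Q 0) \<or> (\<forall>Q\<in>\<P>. v \<noteq> seg Q 1)"
    using fibre_has_free_end[OF \<pi>_seg_0[OF P]] by metis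
  define r where "r y z \<longleftrightarrow> (\<exists>Q\<in>\<P>. y = seg Q 0 \<and> z = seg Q 1)" for y z
  have sym: "r y z \<or> r z y \<longleftrightarrow> (\<exists>Q\<in>\<P>. {y, z} = {seg Q 0, seg Q 1})" for y z
    unfolding r_def doubleton_eq_iff by blast
  have xv: "\<pi> x = \<pi> v" and vM: "\<pi> v \<in> M"
    using x(2) v(2) \<pi>_seg_0[OF P] by auto
  from v(3) show ?thesis
  proof
    assume sink: "\<forall>Q\<in>\<P>. v \<noteq> seg Q 0"
    show ?thesis
    proof (rule alternating_fibre[of r v])
      show "y = z" if "r x y" "r x z" for x y z
        using that segments_meeting_at_start unfolding r_def by blast
      show "\<not> r v y" for y
        using sink by (simp add: r_def)
    qed (fact sym v(1) vM x(1) xv)+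
  next
    assume sink: "\<forall>Q\<in>\<P>. v \<noteq> seg Q 1"
    show ?thesis
    proof (rule alternating_fibre[of "r\<inverse>\<inverse>" v])
      show "y = z" if "r\<inverse>\<inverse> x y" "r\<inverse>\<inverse> x z" for x y z
        using that segments_meeting_at_end unfolding r_def by blast
      show "\<not> r\<inverse>\<inverse> v y" for y
        using sink by (simp add: r_def)
      show "r\<inverse>\<inverse> y z \<or> r\<inverse>\<inverse> z y \<longleftrightarrow> (\<exists>Q\<in>\<P>. {y, z} = {seg Q 0, seg Q 1})" for y z
        using sym[of y z] by auto
    qed (fact v(1) vM x(1) xv)+
  qed
qed

lemma fixed_iff:
  assumes x: "x \<in> topspace Y"
  shows "equivclp (Psi_step \<P> E \<phi>) (b, x) (\<not> b, x) \<longleftrightarrow> (\<exists>P\<in>\<P>. x = seg P (1/2))"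
proof
  assume "\<exists>P\<in>\<P>. x = seg P (1/2)"
  then have "Psi_step \<P> E \<phi> (True, x) (False, x)"
    unfolding Psi_step_iff by force
  then have "equivclp (Psi_step \<P> E \<phi>) (True, x) (False, x)"
    by (rule r_into_equivclp)
  then show "equivclp (Psi_step \<P> E \<phi>) (b, x) (\<not> b, x)"
    by (cases b) (auto intro: equivclp_sym)
next
  assume eq: "equivclp (Psi_step \<P> E \<phi>) (b, x) (\<not> b, x)"
  have "\<exists>P\<in>\<P>. x \<in> E P"
  proof (rule ccontr)
    assume "\<not> ?thesis"
    then have off: "x \<noteq> seg P t" if "P \<in> \<P>" "t \<in> {0..1}" for P t
      using that seg_mem by blast
    have "(b, x) \<in> {(b, x)} \<longleftrightarrow> (\<not> b, x) \<in> {(b, x)}"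
      using eq
    proof (rule equivclp_invariant)
      fix u w assume "Psi_step \<P> E \<phi> u w"
      then obtain Q t where "Q \<in> \<P>" "t \<in> {0..1}" "u = (True, seg Q t)" "w = (False, seg Q (1 - t))"
        using Psi_step_iff by blast
      then have "u \<noteq> (b, x)" "w \<noteq> (b, x)"
        using off[of Q t] off[of Q "1 - t"] by auto
      then show "u \<in> {(b, x)} \<longleftrightarrow> w \<in> {(b, x)}"
        by simp
    qed
    then show False
      by simp
  qed
  then obtain P t where P: "P \<in> \<P>" and t: "t \<in> {0..1}" "x = seg P t"
    using mem_E_iff by blast
  have "t \<noteq> 0" "t \<noteq> 1"
    using end_not_fixed[OF P x] eq t(2) \<pi>_seg_1[OF P] by auto
  then have t': "t \<in> {0<..<1}"
    using t(1) by auto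
  \<comment> \<open>Only steps along \<open>P\<close> touch these two points, since \<open>t\<close>
    is an inner parameter, so the pair is closed under gluing. The other copy of \<open>x\<close>
    can belong to it only if \<open>t = 1 - t\<close>.\<close>
  let ?S = "{(b, seg P t), (\<not> b, seg P (1 - t))}"
  have "(b, x) \<in> ?S \<longleftrightarrow> (\<not> b, x) \<in> ?S"
    using eq
  proof (rule equivclp_invariant)
    fix u w assume "Psi_step \<P> E \<phi> u w"
    then obtain Q s where Q: "Q \<in> \<P>" "s \<in> {0..1}" "u = (True, seg Q s)" "w = (False, seg Q (1 - s))"
      using Psi_step_iff by blast
    have s': "1 - s \<in> {0..1}" and t1: "1 - t \<in> {0<..<1}" "1 - t \<in> {0..1}"
      using Q(2) t' by auto
    show "u \<in> ?S \<longleftrightarrow> w \<in> ?S"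
    proof (cases "Q = P")
      case True
      have "seg P s = seg P t \<longleftrightarrow> s = t" "seg P s = seg P (1 - t) \<longleftrightarrow> s = 1 - t"
        using seg_inject[OF P] Q(2) t(1) t1(2) by blast+
      moreover have "seg P (1 - s) = seg P t \<longleftrightarrow> 1 - s = t"
        "seg P (1 - s) = seg P (1 - t) \<longleftrightarrow> 1 - s = 1 - t"
        using seg_inject[OF P] s' t(1) t1(2) by blast+
      moreover have "1 - s = t \<longleftrightarrow> s = 1 - t" "1 - s = 1 - t \<longleftrightarrow> s = t"
        by auto
      ultimately show ?thesis
        unfolding True Q(3,4) by (cases b) simp_all
    next
      case False
      have "seg Q s \<in> E Q" "seg Q (1 - s) \<in> E Q"
        using seg_mem[OF Q(1)] Q(2) s' by auto
      moreover have "seg P t \<notin> E Q" "seg P (1 - t) \<notin> E Q"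
        using segments_disjoint[OF P Q(1)] False t' t1(1) by auto
      ultimately show ?thesis
        using Q(3,4) by auto
    qed
  qed
  then have "seg P t = seg P (1 - t)"
    using t(2) by auto
  then have "t = 1 - t"
    using seg_inject[OF P t(1), of "1 - t"] t(1) by auto
  then have "t = 1/2"
    by simp
  then show "\<exists>P\<in>\<P>. x = seg P (1/2)"
    using P t(2) by blast
qed

text \<open>Steps lead only from the \<open>True\<close> copy to the \<open>False\<close> copy.
  Exchanging the copies turns the step at \<open>t\<close> into the reverse of the step at
  \<open>1 - t\<close>, which the generated equivalence does not distinguish.\<close>

lemma swap_glue_class:
  "swap_copies ` glue_class (Psi_step \<P> E \<phi>) u = glue_class (Psi_step \<P> E \<phi>) (swap_copies u)"
proof -
  let ?R = "Psi_step \<P> E \<phi>"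
  have invol: "swap_copies (swap_copies u) = u" for u :: "bool \<times> 'b"
    by (cases u) (simp add: swap_copies_def)
  have step: "?R (swap_copies w) (swap_copies u)" if "?R u w" for u w
  proof -
    obtain P t where "P \<in> \<P>" "t \<in> {0..1}" "u = (True, seg P t)" "w = (False, seg P (1 - t))"
      using \<open>?R u w\<close> Psi_step_iff by blast
    then show ?thesis
      unfolding Psi_step_iff swap_copies_def by (intro bexI[of _ P] bexI[of _ "1 - t"]) auto
  qed
  have cong: "equivclp ?R (swap_copies u) (swap_copies w)" if "equivclp ?R u w" for u w
    using that
  proof (induction rule: equivclp_induct)
    case (step y z)
    then have "equivclp ?R (swap_copies y) (swap_copies z)"
      using \<open>\<And>w u. ?R u w \<Longrightarrow> ?R (swap_copies w) (swap_copies u)\<close>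
      by (metis equivclp_sym r_into_equivclp)
    then show ?case
      using step.IH equivclp_trans by metis
  qed simp
  show ?thesis
  proof (intro equalityI subsetI)
    fix w assume "w \<in> swap_copies ` glue_class ?R u"
    then show "w \<in> glue_class ?R (swap_copies u)"
      using cong unfolding glue_class_def by blast
  next
    fix w assume "w \<in> glue_class ?R (swap_copies u)"
    then have "swap_copies w \<in> glue_class ?R u"
      using cong[of "swap_copies u" w] invol by (simp add: glue_class_def)
    then show "w \<in> swap_copies ` glue_class ?R u"
      using invol by (metis imageI)
  qed
qed

lemma swap_continuous: "continuous_map (two_copies Y) (two_copies Y) swap_copies"
  unfolding continuous_map_def
proof (intro conjI allI impI)
  show "swap_copies \<in> topspace (two_copies Y) \<rightarrow> topspace (two_copies Y)"
    by (auto simp: two_copies_def swap_copies_def)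
  fix U assume U: "openin (two_copies Y) U"
  have "{x. (b, x) \<in> {u \<in> topspace (two_copies Y). swap_copies u \<in> U}} = {x. (\<not> b, x) \<in> U}" for b
    using openin_subset[OF U] by (auto simp: two_copies_def swap_copies_def)
  then show "openin (two_copies Y) {u \<in> topspace (two_copies Y). swap_copies u \<in> U}"
    using U by (auto simp: two_copies_def openin_sum_topology)
qed

lemma exchange_homeomorphism:
  defines "D \<equiv> doubled_surface \<P> Y E \<phi>" and "p \<equiv> doubled_proj \<P> E \<phi>"
  assumes ne: "\<P> \<noteq> {}"
  shows "\<exists>\<sigma>. (\<forall>x\<in>topspace (two_copies Y). \<sigma> (p x) = p (swap_copies x)) \<and>
    homeomorphic_map D D \<sigma> \<and>
    (\<forall>z\<in>topspace D. \<sigma> (\<sigma> z) = z) \<and> (\<exists>z\<in>topspace D. \<sigma> z \<noteq> z) \<and>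
    {z \<in> topspace D. \<sigma> z = z} = {p (True, seg P (1/2)) | P. P \<in> \<P>}"
proof -
  \<comment> \<open>As a direct image on arbitrary sets \<open>\<sigma>\<close> is an involution
    without reference to classes; continuity then comes from the universal property of the
    quotient.\<close>
  define \<sigma> :: "(bool \<times> 'b) set \<Rightarrow> (bool \<times> 'b) set" where "\<sigma> = (`) swap_copies"
  have \<sigma>_p: "\<sigma> (p x) = p (swap_copies x)" for x
    by (simp add: \<sigma>_def p_def doubled_proj_def swap_glue_class)
  have invol: "\<sigma> (\<sigma> z) = z" for z
    by (force simp: \<sigma>_def image_image swap_copies_def case_prod_beta)
  have quot: "quotient_map (two_copies Y) D p"
    unfolding D_def p_def doubled_surface_def doubled_proj_def by (rule quotient_map_glue_class)
  have "continuous_map (two_copies Y) D (p \<circ> swap_copies)"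
    using swap_continuous quotient_imp_continuous_map[OF quot] by (rule continuous_map_compose)
  moreover have "p \<circ> swap_copies = \<sigma> \<circ> p"
    using \<sigma>_p by (simp add: fun_eq_iff)
  ultimately have "continuous_map D D \<sigma>"
    using continuous_compose_quotient_map[OF quot] by metis
  then have homeo: "homeomorphic_map D D \<sigma>"
    using homeomorphic_maps_involution invol homeomorphic_map_maps by metis
  have top: "topspace D = p ` (UNIV \<times> topspace Y)"
    using quotient_imp_surjective_map[OF quot] by (simp add: two_copies_def)
  have p_eq: "p u = p w \<longleftrightarrow> equivclp (Psi_step \<P> E \<phi>) u w" for u w
    unfolding p_def doubled_proj_def glue_class_def
    by (metis (mono_tags, lifting) equivclp_refl equivclp_sym equivclp_trans Collect_cong mem_Collect_eq)
  have fixed: "\<sigma> (p (b, x)) = p (b, x) \<longleftrightarrow> (\<exists>P\<in>\<P>. x = seg P (1/2))" if "x \<in> topspace Y" for b x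
  proof -
    have "\<sigma> (p (b, x)) = p (b, x) \<longleftrightarrow> p (b, x) = p (\<not> b, x)"
      by (auto simp: \<sigma>_p swap_copies_def)
    then show ?thesis
      using fixed_iff[OF that] p_eq by simp
  qed
  have mid: "p (b, seg P (1/2)) = p (True, seg P (1/2))" if "P \<in> \<P>" for b P
    using fixed[of "seg P (1/2)" True] seg_topspace[OF that, of "1/2"] that
    by (cases b) (auto simp: \<sigma>_p swap_copies_def)
  obtain P where P: "P \<in> \<P>"
    using ne by blast
  \<comment> \<open>An end of a segment shows that the order is exactly 2.\<close>
  have "\<sigma> (p (True, seg P 0)) \<noteq> p (True, seg P 0)"
  proof
    assume "\<sigma> (p (True, seg P 0)) = p (True, seg P 0)"
    then have "equivclp (Psi_step \<P> E \<phi>) (True, seg P 0) (\<not> True, seg P 0)"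
      using p_eq by (simp add: \<sigma>_p swap_copies_def equivclp_sym)
    then show False
      using end_not_fixed[OF P seg_topspace[OF P, of 0], of True] by simp
  qed
  moreover have "p (True, seg P 0) \<in> topspace D"
    unfolding top using seg_topspace[OF P, of 0] by auto
  ultimately have moved: "\<exists>z\<in>topspace D. \<sigma> z \<noteq> z"
    by blast
  have "{z \<in> topspace D. \<sigma> z = z} = {p (True, seg P (1/2)) | P. P \<in> \<P>}"
  proof (intro equalityI subsetI)
    fix z assume "z \<in> {z \<in> topspace D. \<sigma> z = z}"
    then obtain b x where x: "x \<in> topspace Y" "z = p (b, x)" "\<sigma> z = z"
      unfolding top by auto
    then obtain Q where "Q \<in> \<P>" "x = seg Q (1/2)"
      using fixed by blast
    then show "z \<in> {p (True, seg P (1/2)) | P. P \<in> \<P>}"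
      using mid x(2) by blast
  next
    fix z assume "z \<in> {p (True, seg P (1/2)) | P. P \<in> \<P>}"
    then obtain Q where Q: "Q \<in> \<P>" "z = p (True, seg Q (1/2))"
      by blast
    then have "seg Q (1/2) \<in> topspace Y"
      using seg_topspace by simp
    then show "z \<in> {z \<in> topspace D. \<sigma> z = z}"
      unfolding top using fixed Q by auto
  qed
  then show ?thesis
    using \<sigma>_p homeo invol moved by (intro exI[of _ \<sigma>] conjI) simp_all
qed

end


section \<open>Folded sides end on the boundary\<close>

text \<open>Otherwise the puncture would come both from the circle and from the open disc, against
  injectivity of the parametrization.\<close>

lemma self_folded_base_ne:
  assumes "self_folded_triangle X \<A> V \<tau> \<Delta> L i P"
  shows "L 0 \<noteq> P"
proof
  assume "L 0 = P"
  obtain c where c: "inj_on c (cball (0::complex) 1)" "c ` sphere 0 1 = L ` {0..1}"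
    "c ` ball 0 1 \<inter> V = {P}"
    using assms unfolding self_folded_triangle_def embedded_disc_def by blast
  have "L 0 \<in> c ` sphere 0 1"
    unfolding c(2) by auto
  then obtain z where z: "z \<in> sphere 0 1" "c z = P"
    using \<open>L 0 = P\<close> by auto
  have "P \<in> c ` ball 0 1"
    using c(3) by (metis Int_iff insertI1)
  then obtain w where w: "w \<in> ball 0 1" "c w = P"
    by (metis imageE)
  have "z = w"
    using inj_onD[OF c(1), of z w] z w by auto
  then show False
    using z(1) w(1) by simp
qed

text \<open>The disc cut out by the loop is an open neighbourhood of the puncture that meets no arc
  other than the folded side.\<close>

lemma no_other_arc_at_self_folded_puncture:
  assumes X: "oriented_surface X \<A>"
    and arcs: "\<And>\<alpha>. \<alpha> \<in> \<tau> \<Longrightarrow> arc_in X \<A> V \<alpha>"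
    and nc: "\<And>\<alpha> \<beta>. \<alpha> \<in> \<tau> \<Longrightarrow> \<beta> \<in> \<tau> \<Longrightarrow> \<alpha> \<noteq> \<beta> \<Longrightarrow> noncrossing \<alpha> \<beta>"
    and sf: "self_folded_triangle X \<A> V \<tau> \<Delta> L i P"
    and \<alpha>: "\<alpha> \<in> \<tau>" "\<alpha> \<noteq> i"
  shows "\<alpha> 0 \<noteq> P"
proof
  assume \<alpha>0: "\<alpha> 0 = P"
  obtain c where c: "continuous_map (top_of_set (cball 0 1)) X c" "inj_on c (cball (0::complex) 1)"
    "c ` ball 0 1 \<inter> V = {P}" "\<Delta> = c ` ball 0 1 - i ` {0..1}"
    using sf unfolding self_folded_triangle_def embedded_disc_def by blast
  have tri: "\<Delta> \<in> triangles X \<A> \<tau>" and i: "i \<in> \<tau>"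
    using sf by (auto simp: self_folded_triangle_def)
  have "continuous_map (top_of_set (ball 0 1)) X c"
    using c(1) by (rule continuous_map_from_subtopology_mono[of "euclidean" "cball 0 1", simplified]) auto
  moreover have "inj_on c (ball 0 1)"
    using c(2) ball_subset_cball by (rule inj_on_subset)
  ultimately have "openin X (c ` ball 0 1)"
    by (intro planar_image_open[OF X]) auto
  moreover have "continuous_map (top_of_set {0..1}) X \<alpha>"
    using arcs[OF \<alpha>(1)] by (simp add: arc_in_def pathin_def)
  ultimately have "openin (top_of_set {0..1}) {s \<in> {0..1}. \<alpha> s \<in> c ` ball 0 1}"
    using openin_continuous_map_preimage[of "top_of_set {0..1::real}" X \<alpha>] by simp
  moreover have "0 \<in> {s \<in> {0..1::real}. \<alpha> s \<in> c ` ball 0 1}"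
    using \<alpha>0 c(3) by auto
  ultimately obtain d where d: "d > 0"
    "\<And>s. s \<in> {0..1} \<Longrightarrow> dist s 0 < d \<Longrightarrow> \<alpha> s \<in> c ` ball 0 1"
    unfolding openin_euclidean_subtopology_iff by blast
  \<comment> \<open>The bound 1 keeps \<open>s\<close> an inner parameter, where the arc misses
    \<open>V\<close> and every other arc; the bound \<open>d\<close> keeps it in the disc, which is
    made up of the triangle and points of the folded side.\<close>
  define s where "s = min d 1 / 2"
  have s: "s \<in> {0<..<1}" "s \<in> {0..1}" "\<alpha> s \<in> c ` ball 0 1"
    using d(1) by (auto simp: s_def dist_real_def intro!: d(2))
  have "\<Delta> \<subseteq> topspace X - surface_boundary \<A> - (\<Union>\<alpha> \<in> \<tau>. \<alpha> ` {0..1})"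
    using connected_components_of_subset[OF tri[unfolded triangles_def]] by auto
  then have "\<alpha> s \<notin> \<Delta>"
    using \<alpha>(1) s(2) by blast
  then obtain t where t: "t \<in> {0..1}" "\<alpha> s = i t"
    using s(3) c(4) by blast
  have "\<alpha> ` {0<..<1} \<inter> V = {}" "i 0 \<in> V" "i 1 \<in> V"
    using arcs[OF \<alpha>(1)] arcs[OF i] by (auto simp: arc_in_def)
  then have "t \<noteq> 0" "t \<noteq> 1"
    using imageI[OF s(1), of \<alpha>] t(2) by auto
  then have "t \<in> {0<..<1}"
    using t(1) by auto
  then show False
    using nc[OF \<alpha>(1) i \<alpha>(2)] s(1) t(2) unfolding noncrossing_def by (metis IntI empty_iff imageI)
qed

theorem proposition3p9:
  fixes X :: "'a topology" and \<A> :: "'a chart set" and M \<P> :: "'a set"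
    and \<tau> :: "(real \<Rightarrow> 'a) set" and i :: "'a \<Rightarrow> real \<Rightarrow> 'a"
    and Y :: "'b topology" and \<B> :: "'b chart set" and \<pi> :: "'b \<Rightarrow> 'a"
    and E :: "'a \<Rightarrow> 'b set" and \<phi> :: "'a \<Rightarrow> 'b \<Rightarrow> real"
  assumes "marked_surface X \<A> M \<P>"
    and "surface_boundary \<A> \<noteq> {}"
    and "\<P> \<noteq> {}"
    and "\<not> once_punctured_monogon X M \<P>"
    and "ideal_triangulation X \<A> (M \<union> \<P>) \<tau>"
    and "\<And>P. P \<in> \<P> \<Longrightarrow> \<exists>\<Delta> L. self_folded_triangle X \<A> (M \<union> \<P>) \<tau> \<Delta> L (i P) P"
    and "\<not> triangle_with_two_self_folded_neighbours X \<A> (M \<union> \<P>) \<tau>"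
    and "cut_surface X \<A> \<P> i Y \<B> \<pi> E \<phi>"
  shows "\<exists>\<sigma>. (\<forall>x \<in> topspace (two_copies Y).
            \<sigma> (doubled_proj \<P> E \<phi> x) = doubled_proj \<P> E \<phi> (swap_copies x)) \<and>
          homeomorphic_map (doubled_surface \<P> Y E \<phi>) (doubled_surface \<P> Y E \<phi>) \<sigma> \<and>
          (\<forall>z \<in> topspace (doubled_surface \<P> Y E \<phi>). \<sigma> (\<sigma> z) = z) \<and>
          (\<exists>z \<in> topspace (doubled_surface \<P> Y E \<phi>). \<sigma> z \<noteq> z) \<and>
          {z \<in> topspace (doubled_surface \<P> Y E \<phi>). \<sigma> z = z} =
            {doubled_proj \<P> E \<phi> (True, seg_point E \<phi> P (1/2)) | P. P \<in> \<P>}"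
proof -
  let ?V = "M \<union> \<P>"
  have X: "oriented_surface X \<A>" and M: "finite M" "M \<subseteq> surface_boundary \<A>"
    and \<P>: "\<P> \<inter> surface_boundary \<A> = {}"
    using assms(1) by (auto simp: marked_surface_def)
  have arcs: "arc_in X \<A> ?V \<alpha>" if "\<alpha> \<in> \<tau>" for \<alpha>
    using assms(5) that by (simp add: ideal_triangulation_def)
  have nc: "noncrossing \<alpha> \<beta>" if "\<alpha> \<in> \<tau>" "\<beta> \<in> \<tau>" "\<alpha> \<noteq> \<beta>" for \<alpha> \<beta>
    using assms(5) that by (simp add: ideal_triangulation_def)
  have i_\<tau>: "i P \<in> \<tau>" if "P \<in> \<P>" for P
    using assms(6)[OF that] by (auto simp: self_folded_triangle_def)
  have ends: "\<exists>a\<in>M. {i P 0, i P 1} = {a, P}" if P: "P \<in> \<P>" for P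
  proof -
    obtain \<Delta> L where sf: "self_folded_triangle X \<A> ?V \<tau> \<Delta> L (i P) P"
      using assms(6)[OF P] by blast
    then have L: "L \<in> \<tau>" "L 0 = L 1" "{i P 0, i P 1} = {L 0, P}"
      by (auto simp: self_folded_triangle_def)
    \<comment> \<open>A puncture \<open>L 0\<close> has a folded side of its own, which is not
      closed. The closed loop \<open>L\<close> would thus be a second arc starting at this
      puncture.\<close>
    have "L 0 \<notin> \<P>"
    proof
      assume Q: "L 0 \<in> \<P>"
      then obtain \<Delta>' L' where sf': "self_folded_triangle X \<A> ?V \<tau> \<Delta>' L' (i (L 0)) (L 0)"
        using assms(6) by blast
      have "i (L 0) 0 \<noteq> i (L 0) 1"
        using sf' self_folded_base_ne[OF sf'] by (auto simp: self_folded_triangle_def)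
      then have "L \<noteq> i (L 0)"
        using L(2) by metis
      then show False
        using no_other_arc_at_self_folded_puncture[OF X arcs nc sf' L(1)] by blast
    qed
    moreover have "L 0 \<in> ?V"
      using arcs[OF L(1)] by (simp add: arc_in_def)
    ultimately show ?thesis
      using L(3) by blast
  qed
  interpret folded_cut X \<A> M \<P> i Y \<B> \<pi> E \<phi>
  proof
    show "i P ` {0<..<1} \<inter> (\<P> \<union> surface_boundary \<A>) = {}" if "P \<in> \<P>" for P
      using arcs[OF i_\<tau>[OF that]] by (auto simp: arc_in_def)
    show "i P ` {0<..<1} \<inter> i Q ` {0<..<1} = {}" if PQ: "P \<in> \<P>" "Q \<in> \<P>" "P \<noteq> Q" for P Q
    proof -
      \<comment> \<open>One end is a puncture and the other a boundary point, so the unordered pair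
        of ends determines the puncture.\<close>
      have "i P \<noteq> i Q"
        using ends[OF PQ(1)] ends[OF PQ(2)] PQ M(2) \<P> by (metis disjoint_iff doubleton_eq_iff subset_iff)
      then show ?thesis
        using nc i_\<tau> PQ by (simp add: noncrossing_def)
    qed
  qed (fact X M \<P> assms(8) | rule ends, assumption)+
  show ?thesis
    using exchange_homeomorphism[OF assms(3)] .
qed

end
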